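(* Let $n,d\ge 1$ be integers and let $\mathcal{C}_t(\mathbf{x},\mathbf{y})$ be the mean squared derivative cost function. Define, for $t>0$ and $\mathbf{x},\mathbf{y}\in\mathbb{R}^{dn}$, $$\Phi(t,\mathbf{x},\mathbf{y}):=\frac{\beta_d}{t^{\frac{n^2d}{2}}}\exp\Big(-\frac{\mathcal{C}_t(\mathbf{x},\mathbf{y})}{4t}\Big),$$ where $\beta_d$ is the normalising constant. Then $\Phi$ is the fundamental solution of $$\partial_t f(t,x_1,\ldots,x_n)=\sum_{i=2}^n x_i\cdot\nabla_{x_{i-1}}f+\Delta_{x_n}f .$$ That is, for each $\mathbf{y}\in\mathbb{R}^{dn}$, the function $(t,\mathbf{x})\mapsto\Phi(t,\mathbf{x},\mathbf{y})$ satisfies this equation for $t>0$, $\mathbf{x}\in\mathbb{R}^{dn}$, and in addition $$\lim_{t\to0}\Phi(t,\mathbf{x},\mathbf{y})=\delta_{\mathbf{x}=\mathbf{y}}$$ (the Dirac measure at $\mathbf{y}$, the limit being in the sense of distributions in $\mathbf{x}$).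
   Context: Points of $\mathbb{R}^{dn}$ are written $\mathbf{x}=(x_1,\ldots,x_n)$ with each $x_i\in\mathbb{R}^d$. $\nabla_{x_i}$ and $\Delta_{x_i}$ denote the gradient and Laplacian with respect to the variable $x_i\in\mathbb{R}^d$ only. The mean squared derivative cost function is, for $t>0$ and $\mathbf{x},\mathbf{y}\in\mathbb{R}^{dn}$, $$\mathcal{C}_t(\mathbf{x},\mathbf{y}):=t\,\inf_{\xi}\int_0^t|\xi^{(n)}(s)|^2\,ds,$$ where the infimum is over all $\xi\in C^n([0,t],\mathbb{R}^d)$ with $(\xi,\dot\xi,\ldots,\xi^{(n-1)})(0)=(x_1,\ldots,x_n)$ and $(\xi,\dot\xi,\ldots,\xi^{(n-1)})(t)=(y_1,\ldots,y_n)$. The normalising constant $\beta_d>0$ (independent of $t,\mathbf{x},\mathbf{y}$, depending on $d$ and $n$) is the one for which $\int_{\mathbb{R}^{dn}}\Phi(t,\mathbf{x},\mathbf{y})\,d\mathbf{x}=1$. *)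

theory Defs
  imports "HOL-Analysis.Analysis"
begin

(* R^(dn) is (real^'d)^'n with d = CARD('d) and n = CARD('n). The finite index type 'n is linearly
   ordered, so it is {1 < ... < n} up to a unique order isomorphism: ith k is its k-th element, and
   block x k is x_k for k = 1, ..., n. *)

type_synonym ('d, 'n) points = "((real, 'd) vec, 'n) vec"

definition ith :: "nat \<Rightarrow> 'n::{finite,linorder}" where
  "ith k = (THE i. card {..i} = k)"

definition block :: "('a, 'n::{finite,linorder}) vec \<Rightarrow> nat \<Rightarrow> 'a" where
  "block x k = x $ ith k"

definition set_block :: "('a, 'n::{finite,linorder}) vec \<Rightarrow> nat \<Rightarrow> 'a \<Rightarrow> ('a, 'n) vec" where
  "set_block x k v = (\<chi> i. if i = ith k then v else x $ i)"

(* Derivatives of paths are relative to S = {0..t}, hence one-sided at the endpoints. *)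

definition path_deriv :: "real set \<Rightarrow> nat \<Rightarrow> (real \<Rightarrow> 'a::real_normed_vector) \<Rightarrow> real \<Rightarrow> 'a" where
  "path_deriv S k = (\<lambda>\<eta> s. vector_derivative \<eta> (at s within S)) ^^ k"

definition path_Ck_on :: "nat \<Rightarrow> real set \<Rightarrow> (real \<Rightarrow> 'a::real_normed_vector) \<Rightarrow> bool" where
  "path_Ck_on k S \<xi> \<longleftrightarrow>
     (\<forall>j<k. path_deriv S j \<xi> differentiable_on S) \<and> continuous_on S (path_deriv S k \<xi>)"

definition admissible_paths ::
  "real \<Rightarrow> ('d::finite, 'n::{finite,linorder}) points \<Rightarrow> ('d, 'n) points \<Rightarrow> (real \<Rightarrow> real^'d) set" where
  "admissible_paths t x y =
     {\<xi>. path_Ck_on CARD('n) {0..t} \<xi> \<and>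
         (\<forall>i\<in>{1..CARD('n)}. path_deriv {0..t} (i - 1) \<xi> 0 = block x i \<and>
                             path_deriv {0..t} (i - 1) \<xi> t = block y i)}"

definition msd_cost ::
  "real \<Rightarrow> ('d::finite, 'n::{finite,linorder}) points \<Rightarrow> ('d, 'n) points \<Rightarrow> real" where
  "msd_cost t x y =
     t * (INF \<xi>\<in>admissible_paths t x y.
            integral {0..t} (\<lambda>s. (norm (path_deriv {0..t} CARD('n) \<xi> s))\<^sup>2))"

definition kernel ::
  "real \<Rightarrow> real \<Rightarrow> ('d::finite, 'n::{finite,linorder}) points \<Rightarrow> ('d, 'n) points \<Rightarrow> real" where
  "kernel \<beta> t x y =
     \<beta> / t powr (real (CARD('n)\<^sup>2 * CARD('d)) / 2) * exp (- msd_cost t x y / (4 * t))"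

definition is_normalising :: "('d::finite, 'n::{finite,linorder}) points itself \<Rightarrow> real \<Rightarrow> bool" where
  "is_normalising T \<beta> \<longleftrightarrow>
     \<beta> > 0 \<and> (\<forall>t>0. \<forall>y::('d, 'n) points. (LINT x|lborel. kernel \<beta> t x y) = 1)"

definition normalising_constant :: "('d::finite, 'n::{finite,linorder}) points itself \<Rightarrow> real" where
  "normalising_constant T = (THE \<beta>. is_normalising T \<beta>)"

definition Phi ::
  "real \<Rightarrow> ('d::finite, 'n::{finite,linorder}) points \<Rightarrow> ('d, 'n) points \<Rightarrow> real" where
  "Phi t x y = kernel (normalising_constant TYPE(('d, 'n) points)) t x y"

definition partial_deriv :: "'a::real_normed_vector \<Rightarrow> ('a \<Rightarrow> real) \<Rightarrow> 'a \<Rightarrow> real" where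
  "partial_deriv b f x = deriv (\<lambda>s. f (x + s *\<^sub>R b)) 0"

definition gradient :: "('a::real_inner \<Rightarrow> real) \<Rightarrow> 'a \<Rightarrow> 'a" where
  "gradient f x = (THE D. GDERIV f x :> D)"

definition laplacian :: "('a::euclidean_space \<Rightarrow> real) \<Rightarrow> 'a \<Rightarrow> real" where
  "laplacian f x = (\<Sum>b\<in>Basis. partial_deriv b (partial_deriv b f) x)"

definition gradient_block ::
  "nat \<Rightarrow> (('d::finite, 'n::{finite,linorder}) points \<Rightarrow> real) \<Rightarrow> ('d, 'n) points \<Rightarrow> real^'d" where
  "gradient_block k f x = gradient (\<lambda>v. f (set_block x k v)) (block x k)"

definition laplacian_block ::
  "nat \<Rightarrow> (('d::finite, 'n::{finite,linorder}) points \<Rightarrow> real) \<Rightarrow> ('d, 'n) points \<Rightarrow> real" where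
  "laplacian_block k f x = laplacian (\<lambda>v. f (set_block x k v)) (block x k)"

(* Only meant for open U: partial_deriv b f x uses values of f near x. *)
primrec Ck_on :: "nat \<Rightarrow> 'a::euclidean_space set \<Rightarrow> ('a \<Rightarrow> real) \<Rightarrow> bool" where
  "Ck_on 0 U f \<longleftrightarrow> continuous_on U f"
| "Ck_on (Suc k) U f \<longleftrightarrow>
     f differentiable_on U \<and> (\<forall>b\<in>Basis. Ck_on k U (partial_deriv b f))"

definition test_function :: "('a::euclidean_space \<Rightarrow> real) \<Rightarrow> bool" where
  "test_function \<phi> \<longleftrightarrow> (\<forall>k. Ck_on k UNIV \<phi>) \<and> compact (closure {x. \<phi> x \<noteq> 0})"

(* The C^2 requirement makes f a classical solution: every derivative in the equation exists, so none
   of the totalised operators above takes an arbitrary value. *)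

definition kolmogorov_solution ::
  "(real \<Rightarrow> ('d::finite, 'n::{finite,linorder}) points \<Rightarrow> real) \<Rightarrow> bool" where
  "kolmogorov_solution f \<longleftrightarrow>
     Ck_on 2 ({0<..} \<times> UNIV) (\<lambda>(t, x). f t x) \<and>
     (\<forall>t>0. \<forall>x. deriv (\<lambda>s. f s x) t =
        (\<Sum>i=2..CARD('n). block x i \<bullet> gradient_block (i - 1) (f t) x)
        + laplacian_block CARD('n) (f t) x)"

definition tends_to_dirac ::
  "(real \<Rightarrow> 'a::euclidean_space \<Rightarrow> real) \<Rightarrow> 'a \<Rightarrow> bool" where
  "tends_to_dirac f y \<longleftrightarrow>
     (\<forall>\<phi>. test_function \<phi> \<longrightarrow>
        ((\<lambda>t. LINT x|lborel. f t x * \<phi> x) \<longlongrightarrow> \<phi> y) (at_right 0))"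

definition is_fundamental_solution ::
  "(real \<Rightarrow> ('d::finite, 'n::{finite,linorder}) points \<Rightarrow> ('d, 'n) points \<Rightarrow> real) \<Rightarrow> bool" where
  "is_fundamental_solution F \<longleftrightarrow>
     (\<forall>y. kolmogorov_solution (\<lambda>t x. F t x y) \<and> tends_to_dirac (\<lambda>t x. F t x y) y)"

end

theory Submission
  imports Defs "HOL-Probability.Distributions"
begin

text \<open>
  The argument rests on an explicit formula for the cost. Let \<open>\<xi>\<close> be an admissible path, with
  initial derivatives \<open>x i\<close> and final derivatives \<open>y i\<close>. Integrating by parts \<open>n\<close> times, the
  integral of \<open>q (t - s) * (\<xi>\<^sup>(\<^sup>n\<^sup>)) s\<close> over \<open>{0..t}\<close>, for a polynomial \<open>q\<close> of degree below \<open>n\<close>, equals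
  a linear expression \<open>boundary n t x y q\<close> in the end data alone (\<open>has_integral_boundary\<close>).
  Conversely, these numbers determine whether a function is the \<open>n\<close>-th derivative of an
  admissible path. So the problem is to minimise an \<open>L\<^sup>2\<close> norm with prescribed inner products
  against the polynomials of degree below \<open>n\<close>: the minimiser is itself such a polynomial \<open>w\<close> (up
  to time reversal), and by Parseval the minimum is the sum of the squares of the values of
  \<open>boundary\<close> on an orthonormal basis. With Legendre polynomials rescaled to \<open>{0..t}\<close> this is
  \<open>action\<close>. Since the coordinates of \<open>\<real>\<^sup>d\<close> decouple, the cost is \<open>t\<close> times a sum of \<open>d\<close> actions
  (\<open>msd_cost_eq\<close>), hence polynomial in \<open>x\<close>, \<open>y\<close> and \<open>1 / t\<close>, and the kernel is smooth.

  For the differential equation write \<open>E\<close> for the sum of the actions and \<open>V\<close> for the drift, the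
  vector with blocks \<open>x\<^sub>2, \<dots>, x\<^sub>n, 0\<close>. Two facts are needed. First, the Hamilton--Jacobi
  equation \<open>(\<partial>\<^sub>t - V \<bullet> \<nabla>) E = - \<bar>w t\<bar>\<^sup>2\<close>: here \<open>E\<close> dominates \<open>2 * boundary w - \<integral> w\<^sup>2\<close>
  with equality at the point where \<open>w\<close> is the minimiser, so the two sides have the same derivative
  there, and moving along the drift the \<open>boundary\<close> term of a fixed polynomial does not change
  (\<open>DERIV_action_drift\<close>). Second, in the last block \<open>E\<close> is quadratic with gradient \<open>-2 w t\<close> and
  second derivative \<open>2 * n\<^sup>2 / t\<close> in each coordinate (\<open>action_shift_last\<close>), because the normalised
  Legendre polynomials satisfy \<open>\<Sum>m<n. (P\<^sub>m 1)\<^sup>2 = \<Sum>m<n. 2 * m + 1 = n\<^sup>2\<close>. The time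
  derivative minus the drift term, and the Laplacian, are then both the kernel times \<open>\<bar>w t\<bar>\<^sup>2 / 4 - n\<^sup>2 * d / (2 * t)\<close>.

  For the normalisation and the initial condition, \<open>E\<close> depends on \<open>x\<close> only through its difference
  from the point \<open>free_flow t y\<close>, from which the uncontrolled motion reaches \<open>y\<close> at time \<open>t\<close>, and scaling
  block \<open>x\<^sub>n\<^sub>-\<^sub>k\<close> by \<open>t powr (k + 1 / 2)\<close> removes the remaining dependence on \<open>t\<close>. The Jacobian of
  this substitution is \<open>t powr (n\<^sup>2 * d / 2)\<close>, which cancels the prefactor of the kernel
  (\<open>integral_kernel\<close>). What is left is a fixed Gaussian integral, so a unique normalising constant
  exists, and the limit \<open>t \<rightarrow> 0\<close> follows by dominated convergence.
\<close>

section \<open>Polynomials on an interval\<close>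

text \<open>Polynomials of degree below \<open>n\<close>. The coefficient form includes the zero polynomial, and makes
  \<open>polys_below 0\<close> the zero space, which a condition on \<open>degree\<close> would not.\<close>

definition polys_below :: "nat \<Rightarrow> real poly set" where
  "polys_below n = {p. \<forall>i\<ge>n. coeff p i = 0}"

definition pint :: "real \<Rightarrow> real poly \<Rightarrow> real" where
  "pint t p = integral {0..t} (poly p)"

text \<open>In this form the degree bound kills the last term of the telescoping sums that integration by
  parts produces.\<close>

lemma polys_below_iff_higher_pderiv:
  "p \<in> polys_below n \<longleftrightarrow> (pderiv ^^ n) p = 0"
proof
  assume "p \<in> polys_below n"
  then show "(pderiv ^^ n) p = 0"
    by (intro poly_eqI) (auto simp: polys_below_def coeff_higher_pderiv)
next
  assume 0: "(pderiv ^^ n) p = 0"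
  have "coeff p i = 0" if "i \<ge> n" for i
  proof -
    have "pochhammer (of_nat (Suc (i - n))) n * coeff p i = 0"
      using arg_cong[OF 0, of "\<lambda>q. coeff q (i - n)"] that by (simp add: coeff_higher_pderiv)
    moreover have "pochhammer (of_nat (Suc (i - n)) :: real) n > 0"
      by (intro pochhammer_pos) simp
    ultimately show ?thesis by simp
  qed
  then show "p \<in> polys_below n" by (simp add: polys_below_def)
qed

lemma zero_in_polys_below [simp]: "0 \<in> polys_below n"
  by (simp add: polys_below_def)

lemma add_in_polys_below: "p \<in> polys_below n \<Longrightarrow> q \<in> polys_below n \<Longrightarrow> p + q \<in> polys_below n"
  by (simp add: polys_below_def)

lemma smult_in_polys_below: "p \<in> polys_below n \<Longrightarrow> smult c p \<in> polys_below n"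
  by (simp add: polys_below_def)

lemma sum_in_polys_below: "(\<And>i. i \<in> I \<Longrightarrow> p i \<in> polys_below n) \<Longrightarrow> sum p I \<in> polys_below n"
  by (induction I rule: infinite_finite_induct) (simp_all add: add_in_polys_below)

lemma degree_in_polys_below: "degree p < n \<Longrightarrow> p \<in> polys_below n"
  by (auto simp: polys_below_def intro: coeff_eq_0)

lemma higher_pderiv_pcompose_linear:
  "(pderiv ^^ k) (pcompose p [:b, c:]) = smult (c ^ k) (pcompose ((pderiv ^^ k) p) [:b, c:])"
  for p :: "real poly"
  by (induction k) (simp_all add: pderiv_pcompose pderiv_smult pderiv_pCons ac_simps)

lemma pcompose_linear_in_polys_below:
  "p \<in> polys_below n \<Longrightarrow> pcompose p [:b, c:] \<in> polys_below n"
  by (simp add: polys_below_iff_higher_pderiv higher_pderiv_pcompose_linear)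

text \<open>Iterated antiderivatives with prescribed constants of integration; for \<open>u = 0\<close> this is Taylor
  interpolation at \<open>a\<close> by a polynomial of degree below \<open>n\<close>.\<close>

lemma ex_poly_with_jet:
  fixes u :: "real poly"
  shows "\<exists>p. (pderiv ^^ n) p = u \<and> (\<forall>i<n. poly ((pderiv ^^ i) p) a = x i)"
proof (induction n arbitrary: x)
  case 0
  show ?case by auto
next
  case (Suc n)
  obtain q where q: "(pderiv ^^ n) q = u" "\<And>i. i < n \<Longrightarrow> poly ((pderiv ^^ i) q) a = x (Suc i)"
    using Suc[of "\<lambda>i. x (Suc i)"] by blast
  define r where "r = Poly (0 # map (\<lambda>i. coeff q i / (Suc i)) [0..<Suc (degree q)])"
  have r: "pderiv r = q"
  proof (rule poly_eqI)
    fix i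
    have "coeff r (Suc i) = coeff q i / Suc i"
      by (cases "i < Suc (degree q)")
        (auto simp: r_def nth_default_def coeff_eq_0 simp del: upt_Suc)
    then show "coeff (pderiv r) i = coeff q i"
      by (simp add: coeff_pderiv)
  qed
  define p where "p = r + [:x 0 - poly r a:]"
  have p: "pderiv p = q" "poly p a = x 0"
    by (simp_all add: p_def r pderiv_add pderiv_pCons)
  have "(pderiv ^^ Suc n) p = u"
    by (simp add: funpow_swap1 p q)
  moreover have "poly ((pderiv ^^ i) p) a = x i" if "i < Suc n" for i
    using that by (cases i) (simp_all add: p q funpow_swap1)
  ultimately show ?case by blast
qed

lemma poly_has_vector_derivative:
  "(poly p has_vector_derivative poly (pderiv p) s) (at s within S)"
  using poly_DERIV[of p s] DERIV_subset has_real_derivative_iff_has_vector_derivative by blast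

lemma pint_pderiv: "t \<ge> 0 \<Longrightarrow> pint t (pderiv p) = poly p t - poly p 0"
  unfolding pint_def
  by (intro integral_unique fundamental_theorem_of_calculus poly_has_vector_derivative)

lemma ex_antiderivative: obtains q :: "real poly" where "pderiv q = p"
  using ex_poly_with_jet[of 1 p] by auto

lemma has_integral_pint: "(poly p has_integral pint t p) {0..t}"
  unfolding pint_def
  by (intro integrable_integral integrable_continuous_interval continuous_on_poly continuous_on_id)

lemma pint_eqI: "(f has_integral i) {0..t} \<Longrightarrow> poly p = f \<Longrightarrow> pint t p = i"
  by (simp add: pint_def integral_unique)

lemma pint_add: "pint t (p + q) = pint t p + pint t q"
  by (rule pint_eqI[OF has_integral_add[OF has_integral_pint has_integral_pint]]) (simp add: fun_eq_iff)

lemma pint_diff: "pint t (p - q) = pint t p - pint t q"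
  by (rule pint_eqI[OF has_integral_diff[OF has_integral_pint has_integral_pint]]) (simp add: fun_eq_iff)

lemma pint_smult: "pint t (smult c p) = c * pint t p"
  by (rule pint_eqI[OF has_integral_mult_right[OF has_integral_pint]]) (simp add: fun_eq_iff)

lemma pint_0 [simp]: "pint t 0 = 0"
  by (simp add: pint_def poly_0[abs_def])

lemma pint_sum: "pint t (sum p I) = (\<Sum>i\<in>I. pint t (p i))"
  by (induction I rule: infinite_finite_induct) (simp_all add: pint_add)

lemma pint_square_nonneg: "pint t (p * p) \<ge> 0"
  unfolding pint_def by (rule integral_nonneg[OF has_integral_integrable[OF has_integral_pint]]) simp

lemma pint_square_eq_0:
  assumes "t > 0" "pint t (p * p) = 0"
  shows "p = 0"
proof -
  have "poly (p * p) s = 0" if "s \<in> {0..t}" for s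
  proof (rule has_integral_0_cbox_imp_0[where a = 0 and b = t and f = "poly (p * p)"])
    show "(poly (p * p) has_integral 0) (cbox 0 t)"
      using has_integral_pint[of "p * p" t] assms(2) by simp
  qed (use assms that in \<open>auto intro!: continuous_intros simp: box_real\<close>)
  then have "{0..t} \<subseteq> {s. poly p s = 0}" by auto
  moreover have "infinite {0..t}" using \<open>t > 0\<close> by simp
  ultimately show ?thesis using poly_roots_finite[of p] finite_subset by blast
qed

lemma pint_rescale:
  assumes "t > 0"
  shows "pint t (pcompose p [:0, 1 / t:]) = t * pint 1 p"
proof -
  obtain q where q: "pderiv q = p" by (rule ex_antiderivative)
  have "pcompose p [:0, 1 / t:] = pderiv (smult t (pcompose q [:0, 1 / t:]))"
    using assms by (simp add: pderiv_smult pderiv_pcompose pderiv_pCons q)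
  then have "pint t (pcompose p [:0, 1 / t:]) = t * (poly q 1 - poly q 0)"
    using assms by (simp only: pint_pderiv) (simp add: poly_pcompose algebra_simps)
  then show ?thesis using pint_pderiv[of 1 q] q by simp
qed

lemma pint_reflect:
  assumes "t > 0"
  shows "pint t (pcompose p [:t, -1:]) = pint t p"
proof -
  obtain q where q: "pderiv q = p" by (rule ex_antiderivative)
  have "pcompose p [:t, -1:] = pderiv (- pcompose q [:t, -1:])"
    by (simp add: pderiv_minus pderiv_pcompose pderiv_pCons q)
  then have "pint t (pcompose p [:t, -1:]) = poly q t - poly q 0"
    using assms by (simp only: pint_pderiv) (simp add: poly_pcompose)
  then show ?thesis using pint_pderiv[of t q] q assms by simp
qed

section \<open>Legendre polynomials\<close>

text \<open>Up to sign, the \<open>m\<close>-th shifted Legendre polynomial, normalised in \<open>L\<^sup>2[0,1]\<close>. The sign is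
  immaterial: each of these polynomials enters the later formulas quadratically.\<close>

definition is_legendre :: "nat \<Rightarrow> real poly \<Rightarrow> bool" where
  "is_legendre m e \<longleftrightarrow> degree e = m \<and> pint 1 (e * e) = 1 \<and> (\<forall>q\<in>polys_below m. pint 1 (e * q) = 0)"

text \<open>The degrees are exactly \<open>0, \<dots>, n - 1\<close>, so the leading terms can be eliminated one by one.\<close>

lemma is_legendre_span:
  assumes "\<And>m. m < n \<Longrightarrow> is_legendre m (e m)" and "q \<in> polys_below n"
  shows "\<exists>c. q = (\<Sum>m<n. smult (c m) (e m))"
  using assms
proof (induction n arbitrary: q)
  case 0
  then show ?case by (auto simp: polys_below_def poly_eq_iff)
next
  case (Suc n)
  have en: "degree (e n) = n" "e n \<noteq> 0"
    using Suc.prems(1)[of n] by (auto simp: is_legendre_def)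
  define a where "a = coeff q n / lead_coeff (e n)"
  have "coeff (q - smult a (e n)) i = 0" if "i \<ge> n" for i
  proof (cases "i = n")
    case True
    moreover have "coeff (e n) n \<noteq> 0" using en by (metis leading_coeff_0_iff)
    ultimately show ?thesis using en by (simp add: a_def)
  next
    case False
    then show ?thesis using that Suc.prems(2) en by (simp add: polys_below_def coeff_eq_0)
  qed
  then have "q - smult a (e n) \<in> polys_below n" by (simp add: polys_below_def)
  then obtain c where "q - smult a (e n) = (\<Sum>m<n. smult (c m) (e m))"
    using Suc.IH Suc.prems(1) by (meson less_SucI)
  then have "q = (\<Sum>m<Suc n. smult ((c(n := a)) m) (e m))"
    by (simp add: diff_eq_eq)
  then show ?case by blast
qed

text \<open>Gram--Schmidt: subtract from \<open>X\<^sup>m\<close> its projection onto the polynomials of lower degree.\<close>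

lemma ex_is_legendre: "\<exists>e. is_legendre m e"
proof (induction m rule: less_induct)
  case (less m)
  then obtain e where e: "\<And>l. l < m \<Longrightarrow> is_legendre l (e l)" by metis
  have orth: "pint 1 (e l * e k) = (if l = k then 1 else 0)" if "l < m" "k < m" for k l
  proof -
    have "pint 1 (e l * e k) = 0" if "k < l" "l < m" for k l
      using e[of l] e[of k] that by (simp add: is_legendre_def degree_in_polys_below)
    from this[of k l] this[of l k] show ?thesis
      using that e[of k]
      by (cases l k rule: linorder_cases) (simp_all add: is_legendre_def mult.commute[of "e l" "e k"])
  qed
  define x where "x = (monom 1 m :: real poly)"
  define p where "p = x - (\<Sum>l<m. smult (pint 1 (x * e l)) (e l))"
  have "(\<Sum>l<m. smult (pint 1 (x * e l)) (e l)) \<in> polys_below m"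
    using e by (intro sum_in_polys_below smult_in_polys_below degree_in_polys_below)
      (auto simp: is_legendre_def)
  then have coeff_p: "coeff p m = 1" "\<And>i. i > m \<Longrightarrow> coeff p i = 0"
    by (auto simp: p_def x_def polys_below_def)
  then have deg_p: "degree p = m"
    by (intro antisym degree_le le_degree) auto
  have p_e: "pint 1 (p * e k) = 0" if "k < m" for k
  proof -
    have "(\<Sum>l<m. pint 1 (x * e l) * pint 1 (e l * e k)) = (\<Sum>l<m. if l = k then pint 1 (x * e k) else 0)"
      using that orth by (intro sum.cong) auto
    then show ?thesis
      using that by (simp add: p_def left_diff_distrib sum_distrib_right pint_diff pint_sum pint_smult)
  qed
  have p_q: "pint 1 (p * q) = 0" if "q \<in> polys_below m" for q
  proof -
    have "\<exists>c. q = (\<Sum>l<m. smult (c l) (e l))"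
      by (rule is_legendre_span) (use e that in auto)
    then obtain c where "q = (\<Sum>l<m. smult (c l) (e l))" ..
    then show ?thesis using p_e by (simp add: sum_distrib_left pint_sum pint_smult)
  qed
  have "pint 1 (p * p) \<noteq> 0" using coeff_p(1) pint_square_eq_0[of 1 p] by auto
  then have pos: "pint 1 (p * p) > 0" using pint_square_nonneg[of 1 p] by simp
  then have "is_legendre m (smult (1 / sqrt (pint 1 (p * p))) p)"
    using deg_p p_q by (simp add: is_legendre_def pint_smult)
  then show ?case by blast
qed

definition legendre :: "nat \<Rightarrow> real poly" where
  "legendre m = (SOME e. is_legendre m e)"

lemma is_legendre_legendre: "is_legendre m (legendre m)"
  unfolding legendre_def using someI_ex[OF ex_is_legendre] .

lemma degree_legendre [simp]: "degree (legendre m) = m"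
  using is_legendre_legendre[of m] by (simp add: is_legendre_def)

lemma legendre_in_polys_below: "m < n \<Longrightarrow> legendre m \<in> polys_below n"
  by (simp add: degree_in_polys_below)

lemma pint_legendre_polys_below: "q \<in> polys_below m \<Longrightarrow> pint 1 (legendre m * q) = 0"
  using is_legendre_legendre[of m] by (simp add: is_legendre_def)

lemma pint_legendre: "pint 1 (legendre l * legendre m) = (if l = m then 1 else 0)"
proof (cases l m rule: linorder_cases)
  case less
  then show ?thesis
    using pint_legendre_polys_below[OF legendre_in_polys_below, of l m] by (simp add: mult.commute)
next
  case equal
  then show ?thesis using is_legendre_legendre[of m] by (simp add: is_legendre_def)
next
  case greater
  then show ?thesis
    using pint_legendre_polys_below[OF legendre_in_polys_below, of m l] by simp
qed

text \<open>Integrate \<open>(X * e\<^sup>2)' = e\<^sup>2 + 2 * e * (X * e')\<close> over \<open>[0,1]\<close>. The Euler operator multiplies the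
  leading term by \<open>m\<close>, so \<open>X * e' = m * e + r\<close> with \<open>r\<close> of lower degree and therefore orthogonal
  to \<open>e\<close>.\<close>

lemma legendre_at_1_sq: "(poly (legendre m) 1)\<^sup>2 = 2 * m + 1"
proof -
  define e x r where "e = legendre m" and "x = [:0, 1::real:]" and "r = x * pderiv e - smult m e"
  have "coeff r i = 0" if "i \<ge> m" for i
    using that coeff_eq_0[of e i] by (cases i) (auto simp: r_def x_def e_def coeff_pCons coeff_pderiv)
  then have "pint 1 (e * r) = 0"
    unfolding e_def by (intro pint_legendre_polys_below) (simp add: polys_below_def)
  moreover have "pderiv (x * (e * e)) = e * e + ((x * pderiv e) * e + (x * pderiv e) * e)"
    by (simp add: pderiv_mult x_def pderiv_pCons algebra_simps)
  moreover have "(x * pderiv e) * e = e * r + smult m (e * e)"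
    by (simp add: r_def algebra_simps)
  moreover have "pint 1 (e * e) = 1" by (simp add: e_def pint_legendre)
  ultimately have "pint 1 (pderiv (x * (e * e))) = 1 + 2 * m"
    by (simp only: pint_add pint_smult)
  then have "poly (x * (e * e)) 1 = 1 + 2 * m"
    using pint_pderiv[of 1 "x * (e * e)"] by (simp add: x_def)
  then show ?thesis by (simp add: e_def x_def power2_eq_square)
qed

text \<open>This is where the exponent \<open>n\<^sup>2\<close> in the prefactor of the kernel comes from, on the side of the
  Laplacian.\<close>

lemma sum_legendre_at_1_sq: "(\<Sum>m<n. (poly (legendre m) 1)\<^sup>2) = (real n)\<^sup>2"
proof (induction n)
  case (Suc n)
  then show ?case
    by (simp add: legendre_at_1_sq power2_sum)
qed simp

section \<open>The minimal action\<close>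

text \<open>The value of the integral of \<open>q (t - s) * \<xi>\<^sup>(\<^sup>n\<^sup>) s\<close> over \<open>{0..t}\<close> for a path \<open>\<xi>\<close> with derivatives
  \<open>x i\<close> at \<open>0\<close> and \<open>y i\<close> at \<open>t\<close>, where \<open>i < n\<close>. Testing against the reversed polynomial makes the
  terms in \<open>y\<close> independent of \<open>t\<close>, which is convenient because \<open>y\<close> is fixed and \<open>t\<close> varies in the
  differential equation.\<close>

definition boundary :: "nat \<Rightarrow> real \<Rightarrow> (nat \<Rightarrow> real) \<Rightarrow> (nat \<Rightarrow> real) \<Rightarrow> real poly \<Rightarrow> real" where
  "boundary n t x y q = (\<Sum>k<n. poly ((pderiv ^^ k) q) 0 * y (n - Suc k)
                                - poly ((pderiv ^^ k) q) t * x (n - Suc k))"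

lemma boundary_add: "boundary n t x y (p + q) = boundary n t x y p + boundary n t x y q"
  by (simp add: boundary_def higher_pderiv_add ring_distribs sum.distrib sum_subtractf)

lemma boundary_smult: "boundary n t x y (smult c p) = c * boundary n t x y p"
  by (simp add: boundary_def higher_pderiv_smult sum_distrib_left algebra_simps)

lemma boundary_sum: "boundary n t x y (sum p I) = (\<Sum>i\<in>I. boundary n t x y (p i))"
  by (induction I rule: infinite_finite_induct) (simp_all add: boundary_add, simp_all add: boundary_def)

text \<open>The \<open>n\<close>-fold integration by parts in one step: the primitive \<open>G\<close> has a derivative that telescopes
  to its first term, the last one containing the \<open>n\<close>-th derivative of \<open>q\<close>.\<close>

lemma has_integral_boundary:
  assumes t: "t \<ge> 0" and q: "q \<in> polys_below n"
    and D: "\<And>i s. i < n \<Longrightarrow> s \<in> {0..t} \<Longrightarrow>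
      (D i has_vector_derivative D (Suc i) s) (at s within {0..t})"
  shows "((\<lambda>s. poly q (t - s) * D n s) has_integral
     boundary n t (\<lambda>i. D i 0) (\<lambda>i. D i t) q) {0..t}"
proof -
  define a where "a k s = poly ((pderiv ^^ k) q) (t - s) * D (n - k) s" for k s
  define G where "G s = (\<Sum>k<n. poly ((pderiv ^^ k) q) (t - s) * D (n - Suc k) s)" for s
  have dG: "(G has_vector_derivative poly q (t - s) * D n s) (at s within {0..t})"
    if s: "s \<in> {0..t}" for s
  proof -
    have "((\<lambda>s. poly ((pderiv ^^ k) q) (t - s) * D (n - Suc k) s) has_real_derivative
        a k s - a (Suc k) s) (at s within {0..t})" if "k < n" for k
    proof -
      have d1: "(D (n - Suc k) has_real_derivative D (n - k) s) (at s within {0..t})"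
        using D[of "n - Suc k" s] s that
        by (simp add: has_real_derivative_iff_has_vector_derivative Suc_diff_Suc)
      have d2: "((\<lambda>s. poly ((pderiv ^^ k) q) (t - s)) has_real_derivative
          - poly ((pderiv ^^ Suc k) q) (t - s)) (at s within {0..t})"
        by (rule derivative_eq_intros DERIV_chain2[OF poly_DERIV] refl)+ simp
      show ?thesis
        by (rule DERIV_cong[OF DERIV_mult[OF d2 d1]]) (simp add: a_def)
    qed
    then have "(G has_real_derivative (\<Sum>k<n. a k s - a (Suc k) s)) (at s within {0..t})"
      unfolding G_def by (intro DERIV_sum) auto
    also have "(\<Sum>k<n. a k s - a (Suc k) s) = a 0 s - a n s"
      by (rule sum_lessThan_telescope')
    also have "\<dots> = poly q (t - s) * D n s"
      using q by (simp add: a_def polys_below_iff_higher_pderiv)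
    finally show ?thesis by (simp add: has_real_derivative_iff_has_vector_derivative)
  qed
  have "((\<lambda>s. poly q (t - s) * D n s) has_integral G t - G 0) {0..t}"
    by (intro fundamental_theorem_of_calculus t dG)
  also have "G t - G 0 = boundary n t (\<lambda>i. D i 0) (\<lambda>i. D i t) q"
    by (simp add: G_def boundary_def sum_subtractf)
  finally show ?thesis .
qed

text \<open>With zero data at one end, \<open>boundary\<close> determines the data at the other, since a polynomial of degree below \<open>n\<close> can have
  any prescribed derivatives of order below \<open>n\<close> at one point.\<close>

lemma boundary_eq_0_imp:
  assumes "\<And>q. q \<in> polys_below n \<Longrightarrow> boundary n t x y q = 0"
  shows "(\<And>i. i < n \<Longrightarrow> x i = 0) \<Longrightarrow> i < n \<Longrightarrow> y i = 0"
    and "(\<And>i. i < n \<Longrightarrow> y i = 0) \<Longrightarrow> i < n \<Longrightarrow> x i = 0"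
proof -
  have jet: "\<exists>q\<in>polys_below n. \<forall>k<n. poly ((pderiv ^^ k) q) a = (if k = n - Suc i then 1 else 0)"
    for a i
  proof -
    obtain q where "(pderiv ^^ n) q = 0"
      and "\<forall>k<n. poly ((pderiv ^^ k) q) a = (if k = n - Suc i then 1 else 0)"
      using ex_poly_with_jet[of n 0 a "\<lambda>k. if k = n - Suc i then 1 else 0"] by blast
    then show ?thesis by (intro bexI[of _ q]) (simp_all only: polys_below_iff_higher_pderiv)
  qed
  have delta: "(\<Sum>k<n. (if k = n - Suc i then 1 else 0) * z (n - Suc k)) = z i" if "i < n"
    for z :: "nat \<Rightarrow> real" and i
  proof -
    have "(\<Sum>k<n. (if k = n - Suc i then 1 else 0) * z (n - Suc k))
        = (\<Sum>k<n. if k = n - Suc i then z i else 0)"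
      using that by (intro sum.cong) auto
    then show ?thesis using that by simp
  qed
  show "y i = 0" if "\<And>i. i < n \<Longrightarrow> x i = 0" "i < n"
  proof -
    obtain q where q: "q \<in> polys_below n"
      and 1: "\<And>k. k < n \<Longrightarrow> poly ((pderiv ^^ k) q) 0 = (if k = n - Suc i then 1 else 0)"
      using jet[of 0 i] by auto
    have "boundary n t x y q = (\<Sum>k<n. (if k = n - Suc i then 1 else 0) * y (n - Suc k))"
      unfolding boundary_def using that 1 by (intro sum.cong) auto
    then show ?thesis using assms[OF q] delta[of i y] that by simp
  qed
  show "x i = 0" if "\<And>i. i < n \<Longrightarrow> y i = 0" "i < n"
  proof -
    obtain q where q: "q \<in> polys_below n"
      and 1: "\<And>k. k < n \<Longrightarrow> poly ((pderiv ^^ k) q) t = (if k = n - Suc i then 1 else 0)"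
      using jet[of t i] by auto
    have "boundary n t x y q = - (\<Sum>k<n. (if k = n - Suc i then 1 else 0) * x (n - Suc k))"
      unfolding boundary_def sum_negf[symmetric] using that 1 by (intro sum.cong) auto
    then show ?thesis using assms[OF q] delta[of i x] that by simp
  qed
qed

text \<open>The value of \<open>boundary\<close> on the \<open>m\<close>-th Legendre polynomial rescaled to \<open>{0..t}\<close>, written with its
  dependence on \<open>t\<close> explicit.\<close>

definition legendre_coeff :: "nat \<Rightarrow> real \<Rightarrow> (nat \<Rightarrow> real) \<Rightarrow> (nat \<Rightarrow> real) \<Rightarrow> nat \<Rightarrow> real" where
  "legendre_coeff n t x y m = (\<Sum>k<n. (1 / t) ^ k *
     (poly ((pderiv ^^ k) (legendre m)) 0 * y (n - Suc k) - poly ((pderiv ^^ k) (legendre m)) 1 * x (n - Suc k)))"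

text \<open>The least value of the integral of \<open>(\<xi>\<^sup>(\<^sup>n\<^sup>))\<^sup>2\<close> over scalar paths with the given end data. The
  factor \<open>1 / t\<close> accounts for the norm of the rescaled Legendre polynomials.\<close>

definition action :: "nat \<Rightarrow> real \<Rightarrow> (nat \<Rightarrow> real) \<Rightarrow> (nat \<Rightarrow> real) \<Rightarrow> real" where
  "action n t x y = (\<Sum>m<n. (legendre_coeff n t x y m)\<^sup>2) / t"

text \<open>The \<open>n\<close>-th derivative of the optimal path, run backwards in time.\<close>

definition minimiser :: "nat \<Rightarrow> real \<Rightarrow> (nat \<Rightarrow> real) \<Rightarrow> (nat \<Rightarrow> real) \<Rightarrow> real poly" where
  "minimiser n t x y = (\<Sum>m<n. smult (legendre_coeff n t x y m / t) (pcompose (legendre m) [:0, 1 / t:]))"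

lemma minimiser_in_polys_below: "minimiser n t x y \<in> polys_below n"
  unfolding minimiser_def
  by (intro sum_in_polys_below smult_in_polys_below pcompose_linear_in_polys_below legendre_in_polys_below)
    simp

lemma boundary_rescaled_legendre:
  "t > 0 \<Longrightarrow> boundary n t x y (pcompose (legendre m) [:0, 1 / t:]) = legendre_coeff n t x y m"
  unfolding boundary_def legendre_coeff_def
  by (intro sum.cong) (simp_all add: higher_pderiv_pcompose_linear poly_pcompose algebra_simps)

lemma pint_rescaled_legendre:
  assumes "t > 0"
  shows "pint t (pcompose (legendre l) [:0, 1 / t:] * pcompose (legendre m) [:0, 1 / t:])
    = (if l = m then t else 0)"
  using pint_rescale[OF assms, of "legendre l * legendre m"] by (simp add: pcompose_mult pint_legendre)

text \<open>The minimiser represents the functional \<open>boundary\<close> on the polynomials of degree below \<open>n\<close>.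
  In particular its norm is the norm of that functional.\<close>

lemma pint_minimiser:
  assumes t: "t > 0" and q: "q \<in> polys_below n"
  shows "pint t (minimiser n t x y * q) = boundary n t x y q"
proof -
  define e where "e m = pcompose (legendre m) [:0, 1 / t:]" for m
  have "pcompose q [:0, t:] \<in> polys_below n"
    using q by (rule pcompose_linear_in_polys_below)
  then obtain c where "pcompose q [:0, t:] = (\<Sum>m<n. smult (c m) (legendre m))"
    using is_legendre_span[of n legendre] is_legendre_legendre by blast
  then have "pcompose (pcompose q [:0, t:]) [:0, 1 / t:] = (\<Sum>m<n. smult (c m) (e m))"
    by (simp add: pcompose_sum pcompose_smult e_def)
  moreover have "pcompose (pcompose q [:0, t:]) [:0, 1 / t:] = q"
    using t by (simp flip: pcompose_assoc add: pcompose_pCons)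
  ultimately have q_eq: "q = (\<Sum>m<n. smult (c m) (e m))" by simp
  have w: "pint t (minimiser n t x y * e m) = legendre_coeff n t x y m" if "m < n" for m
  proof -
    have "pint t (minimiser n t x y * e m)
        = (\<Sum>l<n. legendre_coeff n t x y l / t * pint t (e l * e m))"
      by (simp add: minimiser_def e_def sum_distrib_right pint_sum pint_smult)
    also have "\<dots> = (\<Sum>l<n. if l = m then legendre_coeff n t x y m else 0)"
      using t by (intro sum.cong) (auto simp: e_def pint_rescaled_legendre)
    also have "\<dots> = legendre_coeff n t x y m" using that by simp
    finally show ?thesis .
  qed
  have "pint t (minimiser n t x y * q) = (\<Sum>m<n. c m * legendre_coeff n t x y m)"
    by (simp add: q_eq sum_distrib_left pint_sum pint_smult w)
  also have "\<dots> = boundary n t x y q"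
    using t by (simp add: q_eq boundary_sum boundary_smult e_def boundary_rescaled_legendre)
  finally show ?thesis .
qed

lemma boundary_minimiser:
  assumes "t > 0"
  shows "boundary n t x y (minimiser n t x y) = action n t x y"
  using assms by (simp add: minimiser_def boundary_sum boundary_smult boundary_rescaled_legendre
      action_def sum_divide_distrib power2_eq_square)

lemma pint_minimiser_sq:
  assumes "t > 0"
  shows "pint t (minimiser n t x y * minimiser n t x y) = action n t x y"
  using assms by (simp add: pint_minimiser minimiser_in_polys_below boundary_minimiser)

text \<open>The dual description of the action, with equality at the minimiser: expand the norm of
  \<open>minimiser - q\<close>. It bounds the action at all end data by a quantity that depends on them only
  through \<open>boundary\<close>.\<close>

lemma action_ge:
  assumes "t > 0" "q \<in> polys_below n"
  shows "action n t x y \<ge> 2 * boundary n t x y q - pint t (q * q)"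
proof -
  define w where "w = minimiser n t x y"
  have "0 \<le> pint t ((w - q) * (w - q))" by (rule pint_square_nonneg)
  also have "(w - q) * (w - q) = w * w - smult 2 (w * q) + q * q"
    by (simp add: algebra_simps numeral_poly smult_add_left[of 1 1, simplified])
  finally show ?thesis
    using assms by (simp add: pint_add pint_diff pint_smult w_def pint_minimiser_sq pint_minimiser)
qed

lemma action_nonneg: "t > 0 \<Longrightarrow> action n t x y \<ge> 0"
  by (simp add: action_def sum_nonneg)

text \<open>Expand the square of the difference of the \<open>n\<close>-th derivative and the reversed minimiser.\<close>

lemma action_le_integral:
  assumes t: "t > 0"
    and D: "\<And>i s. i < n \<Longrightarrow> s \<in> {0..t} \<Longrightarrow>
      (D i has_vector_derivative D (Suc i) s) (at s within {0..t})"
    and cont: "continuous_on {0..t} (D n)"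
  shows "action n t (\<lambda>i. D i 0) (\<lambda>i. D i t) \<le> integral {0..t} (\<lambda>s. (D n s)\<^sup>2)"
proof -
  define w where "w = minimiser n t (\<lambda>i. D i 0) (\<lambda>i. D i t)"
  define r where "r = pcompose (w * w) [:t, -1:]"
  have "((\<lambda>s. poly w (t - s) * D n s) has_integral action n t (\<lambda>i. D i 0) (\<lambda>i. D i t)) {0..t}"
    unfolding boundary_minimiser[OF t, symmetric] w_def
    by (intro has_integral_boundary less_imp_le[OF t] minimiser_in_polys_below D)
  from has_integral_mult_right[OF this, of 2]
  have 1: "((\<lambda>s. 2 * (poly w (t - s) * D n s)) has_integral 2 * action n t (\<lambda>i. D i 0) (\<lambda>i. D i t)) {0..t}" .
  have "(poly r has_integral pint t r) {0..t}" by (rule has_integral_pint)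
  also have "pint t r = action n t (\<lambda>i. D i 0) (\<lambda>i. D i t)"
    using t by (simp add: r_def pint_reflect w_def pint_minimiser_sq)
  also have "poly r = (\<lambda>s. (poly w (t - s))\<^sup>2)"
    by (simp add: r_def poly_pcompose fun_eq_iff power2_eq_square)
  finally have 2: "((\<lambda>s. (poly w (t - s))\<^sup>2) has_integral action n t (\<lambda>i. D i 0) (\<lambda>i. D i t)) {0..t}" .
  have 3: "((\<lambda>s. (D n s)\<^sup>2) has_integral integral {0..t} (\<lambda>s. (D n s)\<^sup>2)) {0..t}"
    by (intro integrable_integral integrable_continuous_interval continuous_on_power cont)
  have "((\<lambda>s. (D n s)\<^sup>2 - 2 * (poly w (t - s) * D n s) + (poly w (t - s))\<^sup>2) has_integral
      integral {0..t} (\<lambda>s. (D n s)\<^sup>2) - 2 * action n t (\<lambda>i. D i 0) (\<lambda>i. D i t)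
        + action n t (\<lambda>i. D i 0) (\<lambda>i. D i t)) {0..t}"
    by (intro has_integral_add has_integral_diff 1 2 3)
  then have "0 \<le> integral {0..t} (\<lambda>s. (D n s)\<^sup>2) - 2 * action n t (\<lambda>i. D i 0) (\<lambda>i. D i t)
        + action n t (\<lambda>i. D i 0) (\<lambda>i. D i t)"
  proof (rule has_integral_nonneg)
    fix s
    have "(D n s)\<^sup>2 - 2 * (poly w (t - s) * D n s) + (poly w (t - s))\<^sup>2 = (D n s - poly w (t - s))\<^sup>2"
      by (simp add: power2_diff)
    then show "0 \<le> (D n s)\<^sup>2 - 2 * (poly w (t - s) * D n s) + (poly w (t - s))\<^sup>2" by simp
  qed
  then show ?thesis by simp
qed

text \<open>Integrate the reversed minimiser \<open>n\<close> times, starting from the data \<open>x\<close>. The final data are then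
  automatically \<open>y\<close>, because both give the same value of \<open>boundary\<close> on every polynomial of degree
  below \<open>n\<close>.\<close>

lemma ex_poly_action:
  assumes t: "t > 0"
  shows "\<exists>p. (\<forall>i<n. poly ((pderiv ^^ i) p) 0 = x i \<and> poly ((pderiv ^^ i) p) t = y i) \<and>
    integral {0..t} (\<lambda>s. (poly ((pderiv ^^ n) p) s)\<^sup>2) = action n t x y"
proof -
  define w where "w = minimiser n t x y"
  obtain p where p: "(pderiv ^^ n) p = pcompose w [:t, -1:]"
    and x: "\<And>i. i < n \<Longrightarrow> poly ((pderiv ^^ i) p) 0 = x i"
    using ex_poly_with_jet[of n "pcompose w [:t, -1:]" 0 x] by auto
  define z where "z i = poly ((pderiv ^^ i) p) t - y i" for i
  have bd: "boundary n t (\<lambda>i. 0) z q = 0" if q: "q \<in> polys_below n" for q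
  proof -
    have "((\<lambda>s. poly q (t - s) * poly ((pderiv ^^ n) p) s) has_integral
       boundary n t (\<lambda>i. poly ((pderiv ^^ i) p) 0) (\<lambda>i. poly ((pderiv ^^ i) p) t) q) {0..t}"
      using t q by (intro has_integral_boundary) (auto intro: poly_has_vector_derivative)
    moreover have "(\<lambda>s. poly q (t - s) * poly ((pderiv ^^ n) p) s) = poly (pcompose (w * q) [:t, -1:])"
      by (simp add: p fun_eq_iff poly_pcompose)
    ultimately have "(poly (pcompose (w * q) [:t, -1:]) has_integral
       boundary n t (\<lambda>i. poly ((pderiv ^^ i) p) 0) (\<lambda>i. poly ((pderiv ^^ i) p) t) q) {0..t}"
      by (simp only:)
    then have "boundary n t (\<lambda>i. poly ((pderiv ^^ i) p) 0) (\<lambda>i. poly ((pderiv ^^ i) p) t) q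
        = pint t (pcompose (w * q) [:t, -1:])"
      by (rule has_integral_unique[OF _ has_integral_pint])
    also have "\<dots> = boundary n t x y q"
      using t q by (simp add: pint_reflect w_def pint_minimiser)
    finally have "0 = boundary n t (\<lambda>i. poly ((pderiv ^^ i) p) 0) (\<lambda>i. poly ((pderiv ^^ i) p) t) q
        - boundary n t x y q" by simp
    also have "\<dots> = boundary n t (\<lambda>i. 0) z q"
      unfolding boundary_def sum_subtractf[symmetric] using x
      by (intro sum.cong) (auto simp: z_def algebra_simps)
    finally show ?thesis by simp
  qed
  have "z i = 0" if "i < n" for i
    using boundary_eq_0_imp(1)[OF bd, of i] that by simp
  moreover have "integral {0..t} (\<lambda>s. (poly ((pderiv ^^ n) p) s)\<^sup>2) = action n t x y"
  proof -
    have "(\<lambda>s. (poly ((pderiv ^^ n) p) s)\<^sup>2) = poly (pcompose (w * w) [:t, -1:])"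
      by (simp add: p fun_eq_iff poly_pcompose power2_eq_square)
    then have "integral {0..t} (\<lambda>s. (poly ((pderiv ^^ n) p) s)\<^sup>2) = pint t (pcompose (w * w) [:t, -1:])"
      by (simp add: pint_def)
    then show ?thesis using t by (simp add: pint_reflect w_def pint_minimiser_sq)
  qed
  ultimately show ?thesis using x by (auto simp: z_def)
qed

section \<open>The cost as a sum of actions\<close>

text \<open>Counting predecessors identifies the index type with \<open>{1..n}\<close>; \<open>ith\<close> is the inverse.\<close>

lemma bij_betw_card_atMost:
  "bij_betw (\<lambda>i::'n::{finite,linorder}. card {..i}) UNIV {1..CARD('n)}"
proof -
  have "inj (\<lambda>i::'n. card {..i})"
  proof (rule linorder_injI)
    fix i j :: 'n assume "i < j"
    then have "{..i} \<subset> {..j}" by auto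
    then have "card {..i} < card {..j}" by (intro psubset_card_mono) auto
    then show "card {..i} \<noteq> card {..j}" by simp
  qed
  moreover have "range (\<lambda>i::'n. card {..i}) = {1..CARD('n)}"
  proof (rule card_subset_eq)
    have "0 < card {..i}" for i :: 'n by (subst card_gt_0_iff) auto
    moreover have "card {..i} \<le> CARD('n)" for i :: 'n by (intro card_mono) auto
    ultimately show "range (\<lambda>i::'n. card {..i}) \<subseteq> {1..CARD('n)}"
      by (auto simp: Suc_le_eq)
    show "card (range (\<lambda>i::'n. card {..i})) = card {1..CARD('n)}"
      using \<open>inj _\<close> by (simp add: card_image)
  qed simp
  ultimately show ?thesis by (simp add: bij_betw_def)
qed

lemma ith_card_atMost [simp]: "ith (card {..i}) = (i :: 'n::{finite,linorder})"
  unfolding ith_def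
  by (rule the_equality) (use bij_betw_card_atMost[where 'n='n] in \<open>auto simp: bij_betw_def inj_def\<close>)

lemma card_atMost_ith:
  assumes "k \<in> {1..CARD('n::{finite,linorder})}"
  shows "card {..ith k :: 'n} = k"
proof -
  obtain i :: 'n where "k = card {..i}"
    using assms bij_betw_imp_surj_on[OF bij_betw_card_atMost[where 'n='n]] by blast
  then show ?thesis by simp
qed

lemma ith_eq_iff:
  "k \<in> {1..CARD('n)} \<Longrightarrow> l \<in> {1..CARD('n)} \<Longrightarrow> ith k = (ith l :: 'n::{finite,linorder}) \<longleftrightarrow> k = l"
  by (metis card_atMost_ith)

lemma bij_betw_ith: "bij_betw (\<lambda>k. ith (Suc k) :: 'n::{finite,linorder}) {..<CARD('n)} UNIV"
proof -
  have "card {..i} - 1 < CARD('n)" for i :: 'n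
    using bij_betw_apply[OF bij_betw_card_atMost[where 'n='n], of i] by simp linarith
  moreover have "Suc (card {..i} - 1) = card {..i}" for i :: 'n
    by (subst Suc_diff_1) (simp_all add: card_gt_0_iff)
  ultimately show ?thesis
    by (intro bij_betwI[where g = "\<lambda>i. card {..i} - 1"]) (auto simp: card_atMost_ith)
qed

text \<open>The derivatives of the \<open>j\<close>-th coordinate of a path, numbered from \<open>0\<close> to \<open>n - 1\<close>; only these
  arguments are meaningful.\<close>

definition coords :: "('d::finite, 'n::{finite,linorder}) points \<Rightarrow> 'd \<Rightarrow> nat \<Rightarrow> real" where
  "coords x j i = block x (Suc i) $ j"

definition total_action :: "real \<Rightarrow> ('d::finite, 'n::{finite,linorder}) points \<Rightarrow> ('d, 'n) points \<Rightarrow> real" where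
  "total_action t x y = (\<Sum>j\<in>UNIV. action CARD('n) t (coords x j) (coords y j))"

lemma path_Ck_on_has_vector_derivative:
  assumes "path_Ck_on n S \<xi>" "i < n" "s \<in> S"
  shows "(path_deriv S i \<xi> has_vector_derivative path_deriv S (Suc i) \<xi> s) (at s within S)"
  using assms vector_derivative_works[of "path_deriv S i \<xi>" "at s within S"]
  by (auto simp: path_Ck_on_def differentiable_on_def path_deriv_def)

lemma integral_norm_sq_vec:
  fixes f :: "real \<Rightarrow> real^'d::finite"
  assumes "continuous_on {a..b} f"
  shows "integral {a..b} (\<lambda>s. (norm (f s))\<^sup>2) = (\<Sum>j\<in>UNIV. integral {a..b} (\<lambda>s. (f s $ j)\<^sup>2))"
proof -
  have "(norm (f s))\<^sup>2 = (\<Sum>j\<in>UNIV. (f s $ j)\<^sup>2)" for s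
    unfolding power2_norm_eq_inner inner_vec_def by (simp add: power2_eq_square)
  then show ?thesis
    using assms by (simp add: integral_sum integrable_continuous_interval continuous_on_power
      continuous_on_component)
qed

lemma total_action_le_integral:
  fixes x y :: "('d::finite, 'n::{finite,linorder}) points"
  assumes t: "t > 0" and \<xi>: "\<xi> \<in> admissible_paths t x y"
  shows "total_action t x y \<le> integral {0..t} (\<lambda>s. (norm (path_deriv {0..t} CARD('n) \<xi> s))\<^sup>2)"
proof -
  let ?n = "CARD('n)"
  have C: "path_Ck_on ?n {0..t} \<xi>"
    and bd: "\<And>i. i \<in> {1..?n} \<Longrightarrow> path_deriv {0..t} (i - 1) \<xi> 0 = block x i \<and>
                             path_deriv {0..t} (i - 1) \<xi> t = block y i"
    using \<xi> by (auto simp: admissible_paths_def)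
  have cont: "continuous_on {0..t} (path_deriv {0..t} ?n \<xi>)"
    using C by (simp add: path_Ck_on_def)
  have "action ?n t (coords x j) (coords y j) \<le> integral {0..t} (\<lambda>s. (path_deriv {0..t} ?n \<xi> s $ j)\<^sup>2)"
    for j
  proof -
    have "action ?n t (coords x j) (coords y j) =
       action ?n t (\<lambda>i. path_deriv {0..t} i \<xi> 0 $ j) (\<lambda>i. path_deriv {0..t} i \<xi> t $ j)"
      using bd[of "Suc _"] unfolding action_def legendre_coeff_def coords_def
      by (intro arg_cong2[where f="(/)"] sum.cong refl arg_cong2[where f="power"]
        arg_cong2[where f="(-)"] arg_cong2[where f="(*)"]) auto
    also have "\<dots> \<le> integral {0..t} (\<lambda>s. (path_deriv {0..t} ?n \<xi> s $ j)\<^sup>2)"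
    proof (rule action_le_integral[OF t])
      fix i s assume "i < ?n" "s \<in> {0..t}"
      then show "((\<lambda>s. path_deriv {0..t} i \<xi> s $ j) has_vector_derivative
          path_deriv {0..t} (Suc i) \<xi> s $ j) (at s within {0..t})"
        by (intro bounded_linear.has_vector_derivative[OF bounded_linear_vec_nth]
            path_Ck_on_has_vector_derivative[OF C])
    qed (intro continuous_on_component cont)
    finally show ?thesis .
  qed
  then show ?thesis
    unfolding total_action_def integral_norm_sq_vec[OF cont] by (rule sum_mono)
qed

lemma has_vector_derivative_vec_lambda:
  fixes f :: "'d::finite \<Rightarrow> real \<Rightarrow> real"
  assumes "\<And>j. (f j has_vector_derivative f' j) (at s within S)"
  shows "((\<lambda>s. \<chi> j. f j s) has_vector_derivative (\<chi> j. f' j)) (at s within S)"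
proof -
  have *: "(\<chi> j. c j) = (\<Sum>j\<in>UNIV. c j *\<^sub>R axis j 1)" for c :: "'d \<Rightarrow> real"
    by (simp add: vec_eq_iff axis_def if_distrib cong: if_cong)
  show ?thesis
    unfolding * by (intro has_vector_derivative_sum
      bounded_linear.has_vector_derivative[OF bounded_linear_scaleR_left] assms)
qed

text \<open>The one-sided derivatives at the end points of \<open>{0..t}\<close> agree with the derivatives of the
  polynomial, because the interval is nondegenerate.\<close>

lemma path_deriv_vec_poly:
  fixes p :: "'d::finite \<Rightarrow> real poly"
  assumes t: "t > 0" and s: "s \<in> {0..t}"
  shows "path_deriv {0..t} k (\<lambda>s. \<chi> j. poly (p j) s) s = (\<chi> j. poly ((pderiv ^^ k) (p j)) s)"
  using s
proof (induction k arbitrary: s)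
  case 0
  then show ?case by (simp add: path_deriv_def)
next
  case (Suc k)
  have "((\<lambda>s. \<chi> j. poly ((pderiv ^^ k) (p j)) s) has_vector_derivative
      (\<chi> j. poly ((pderiv ^^ Suc k) (p j)) s)) (at s within {0..t})"
    by (intro has_vector_derivative_vec_lambda) (simp add: poly_has_vector_derivative)
  then have "(path_deriv {0..t} k (\<lambda>s. \<chi> j. poly (p j) s) has_vector_derivative
      (\<chi> j. poly ((pderiv ^^ Suc k) (p j)) s)) (at s within {0..t})"
    by (rule has_vector_derivative_transform[OF Suc.prems Suc.IH, rotated])
  from vector_derivative_within_closed_interval[OF t Suc.prems this]
  show ?case by (simp add: path_deriv_def)
qed

lemma ex_minimising_path:
  fixes x y :: "('d::finite, 'n::{finite,linorder}) points"
  assumes t: "t > 0"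
  shows "\<exists>\<xi>\<in>admissible_paths t x y.
    integral {0..t} (\<lambda>s. (norm (path_deriv {0..t} CARD('n) \<xi> s))\<^sup>2) = total_action t x y"
proof -
  let ?n = "CARD('n)"
  have "\<forall>j. \<exists>p. (\<forall>i<?n. poly ((pderiv ^^ i) p) 0 = coords x j i \<and> poly ((pderiv ^^ i) p) t = coords y j i) \<and>
      integral {0..t} (\<lambda>s. (poly ((pderiv ^^ ?n) p) s)\<^sup>2) = action ?n t (coords x j) (coords y j)"
    using ex_poly_action[OF t] by blast
  from choice[OF this] obtain p where
    jet: "\<And>j i. i < ?n \<Longrightarrow> poly ((pderiv ^^ i) (p j)) 0 = coords x j i \<and>
                     poly ((pderiv ^^ i) (p j)) t = coords y j i"
    and int: "\<And>j. integral {0..t} (\<lambda>s. (poly ((pderiv ^^ ?n) (p j)) s)\<^sup>2)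
      = action ?n t (coords x j) (coords y j)"
    by auto
  define \<xi> where "\<xi> = (\<lambda>s. \<chi> j. poly (p j) s)"
  define q where "q k = (\<lambda>s. \<chi> j. poly ((pderiv ^^ k) (p j)) s)" for k
  have q: "path_deriv {0..t} k \<xi> s = q k s" if "s \<in> {0..t}" for k s
    unfolding \<xi>_def q_def by (rule path_deriv_vec_poly[OF t that])
  have dq: "(q k has_vector_derivative q (Suc k) s) (at s within {0..t})" for k s
    unfolding q_def by (intro has_vector_derivative_vec_lambda) (simp add: poly_has_vector_derivative)
  have cq: "continuous_on {0..t} (q k)" for k
    unfolding q_def by (intro continuous_on_vec_lambda continuous_on_poly continuous_on_id)
  have "path_Ck_on ?n {0..t} \<xi>"
    unfolding path_Ck_on_def
  proof (intro conjI allI impI)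
    fix k
    show "path_deriv {0..t} k \<xi> differentiable_on {0..t}"
      unfolding differentiable_on_def
    proof
      fix s assume s: "s \<in> {0..t}"
      have "(path_deriv {0..t} k \<xi> has_vector_derivative q (Suc k) s) (at s within {0..t})"
        by (rule has_vector_derivative_transform[OF s q dq])
      then show "path_deriv {0..t} k \<xi> differentiable at s within {0..t}"
        by (auto simp: has_vector_derivative_def intro: differentiableI)
    qed
  next
    show "continuous_on {0..t} (path_deriv {0..t} ?n \<xi>)"
      by (rule continuous_on_eq[OF cq]) (simp add: q)
  qed
  moreover have "path_deriv {0..t} (i - 1) \<xi> 0 = block x i \<and> path_deriv {0..t} (i - 1) \<xi> t = block y i"
    if "i \<in> {1..?n}" for i
  proof -
    have "i - 1 < ?n" using that by auto
    from jet[OF this] show ?thesis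
      using that t by (simp add: q q_def vec_eq_iff coords_def)
  qed
  ultimately have "\<xi> \<in> admissible_paths t x y"
    by (simp add: admissible_paths_def)
  moreover have "integral {0..t} (\<lambda>s. (norm (path_deriv {0..t} ?n \<xi> s))\<^sup>2) = total_action t x y"
  proof -
    have "integral {0..t} (\<lambda>s. (norm (path_deriv {0..t} ?n \<xi> s))\<^sup>2)
        = integral {0..t} (\<lambda>s. (norm (q ?n s))\<^sup>2)"
      by (intro integral_cong) (simp add: q)
    also have "\<dots> = total_action t x y"
      unfolding integral_norm_sq_vec[OF cq] total_action_def by (simp add: q_def int)
    finally show ?thesis .
  qed
  ultimately show ?thesis by blast
qed

lemma msd_cost_eq:
  fixes x y :: "('a::finite, 'b::{finite,linorder}) points"
  assumes "t > 0"
  shows "msd_cost t x y = t * total_action t x y"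
proof -
  have "(INF \<xi>\<in>admissible_paths t x y.
      integral {0..t} (\<lambda>s. (norm (path_deriv {0..t} CARD('b) \<xi> s))\<^sup>2)) = total_action t x y"
  proof (rule cInf_eq_minimum)
    show "total_action t x y \<in> (\<lambda>\<xi>. integral {0..t} (\<lambda>s. (norm (path_deriv {0..t} CARD('b) \<xi> s))\<^sup>2)) `
        admissible_paths t x y"
      using ex_minimising_path[OF assms, of x y] by force
  qed (use total_action_le_integral[OF assms] in auto)
  then show ?thesis by (simp add: msd_cost_def)
qed

lemma kernel_eq:
  fixes x y :: "('d::finite, 'n::{finite,linorder}) points"
  assumes "t > 0"
  shows "kernel \<beta> t x y = \<beta> * t powr - (real (CARD('n)\<^sup>2 * CARD('d)) / 2) * exp (- total_action t x y / 4)"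
  using assms by (simp add: kernel_def msd_cost_eq powr_minus_divide)

section \<open>Derivatives of the action\<close>

lemma poly_minimiser_end:
  "t > 0 \<Longrightarrow> poly (minimiser n t x y) t = (\<Sum>m<n. legendre_coeff n t x y m * poly (legendre m) 1) / t"
  by (simp add: minimiser_def poly_sum poly_pcompose sum_divide_distrib)

lemma legendre_coeff_cong:
  "(\<And>i. i < n \<Longrightarrow> x i = x' i) \<Longrightarrow> (\<And>i. i < n \<Longrightarrow> y i = y' i) \<Longrightarrow>
    legendre_coeff n t x y m = legendre_coeff n t x' y' m"
  unfolding legendre_coeff_def by (intro sum.cong) auto

lemma action_cong:
  assumes "\<And>i. i < n \<Longrightarrow> x i = x' i" "\<And>i. i < n \<Longrightarrow> y i = y' i"
  shows "action n t x y = action n t x' y'"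
  unfolding action_def using legendre_coeff_cong[OF assms] by simp

text \<open>Only the term \<open>k = 0\<close> of \<open>legendre_coeff\<close> contains the last entry of \<open>x\<close>, with the factor
  \<open>- poly (legendre m) 1\<close>. The coefficient \<open>n\<^sup>2\<close> is the sum of the squares of these factors.\<close>

lemma action_shift_last:
  assumes t: "t > 0" and n: "n > 0"
  shows "action n t (\<lambda>i. if i = n - 1 then x i + s else x i) y =
    action n t x y - 2 * s * poly (minimiser n t x y) t + s\<^sup>2 * (real n)\<^sup>2 / t"
proof -
  have "legendre_coeff n t (\<lambda>i. if i = n - 1 then x i + s else x i) y m
      = legendre_coeff n t x y m - s * poly (legendre m) 1" for m
  proof -
    have "legendre_coeff n t x y m - legendre_coeff n t (\<lambda>i. if i = n - 1 then x i + s else x i) y m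
        = (\<Sum>k<n. if k = 0 then s * poly (legendre m) 1 else 0)"
      unfolding legendre_coeff_def sum_subtractf[symmetric]
      using n by (intro sum.cong refl) (auto simp: algebra_simps)
    also have "\<dots> = s * poly (legendre m) 1"
      using n by simp
    finally show ?thesis by simp
  qed
  then have "action n t (\<lambda>i. if i = n - 1 then x i + s else x i) y =
    (\<Sum>m<n. (legendre_coeff n t x y m)\<^sup>2 - 2 * s * (legendre_coeff n t x y m * poly (legendre m) 1)
       + s\<^sup>2 * (poly (legendre m) 1)\<^sup>2) / t"
    unfolding action_def by (intro arg_cong2[where f = "(/)"] sum.cong refl)
      (simp add: power2_diff power_mult_distrib)
  also have "\<dots> = ((\<Sum>m<n. (legendre_coeff n t x y m)\<^sup>2)
      - 2 * s * (\<Sum>m<n. legendre_coeff n t x y m * poly (legendre m) 1)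
      + s\<^sup>2 * (\<Sum>m<n. (poly (legendre m) 1)\<^sup>2)) / t"
    by (simp add: sum.distrib sum_subtractf sum_distrib_left)
  also have "\<dots> = action n t x y - 2 * s * poly (minimiser n t x y) t + s\<^sup>2 * (real n)\<^sup>2 / t"
    using t by (simp add: sum_legendre_at_1_sq poly_minimiser_end action_def diff_divide_distrib add_divide_distrib)
  finally show ?thesis .
qed

lemma action_drift_differentiable:
  assumes "t > 0"
  shows "(\<lambda>s. action n (t + s) (\<lambda>i. x i - s * v i) y) field_differentiable (at 0)"
  unfolding action_def legendre_coeff_def using assms
  by (intro field_differentiable_divide field_differentiable_sum field_differentiable_power
     field_differentiable_mult field_differentiable_diff field_differentiable_add
     field_differentiable_const field_differentiable_ident) auto

lemma DERIV_pint: "((\<lambda>s. pint (t + s) p) has_real_derivative poly p t) (at 0)"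
  if "t > 0"
proof -
  obtain q where q: "pderiv q = p" by (rule ex_antiderivative)
  have "((\<lambda>s. poly q (t + s) - poly q 0) has_real_derivative poly p t) (at 0)"
    by (rule derivative_eq_intros DERIV_chain2[OF poly_DERIV] refl)+ (simp add: q)
  moreover have "eventually (\<lambda>s. s \<in> {-t<..}) (nhds 0)"
    using that by (intro eventually_nhds_in_open) auto
  then have "eventually (\<lambda>s. pint (t + s) p = poly q (t + s) - poly q 0) (nhds 0)"
    by eventually_elim (use pint_pderiv[of "t + _" q] q in simp)
  ultimately show ?thesis by (subst DERIV_cong_ev[OF refl _ refl])
qed

text \<open>The Hamilton--Jacobi equation, by an envelope argument. Freeze the minimiser \<open>w\<close> at the base
  point. By \<open>action_ge\<close> the difference \<open>E - H\<close> has a local minimum at \<open>s = 0\<close>, so \<open>E\<close> and \<open>H\<close> have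
  the same derivative there. The derivative of \<open>H\<close> comes only from the upper limit of the integral
  of \<open>w\<^sup>2\<close>: along the drift the derivative of \<open>boundary\<close> at \<open>w\<close> telescopes to zero.\<close>

lemma DERIV_action_drift:
  fixes x y :: "nat \<Rightarrow> real" and n :: nat
  assumes t: "t > 0"
  defines "v \<equiv> \<lambda>i. if Suc i < n then x (Suc i) else 0"
  shows "((\<lambda>s. action n (t + s) (\<lambda>i. x i - s * v i) y) has_real_derivative
     - (poly (minimiser n t x y) t)\<^sup>2) (at 0)"
proof -
  define w where "w = minimiser n t x y"
  (* X k is the derivative of order n - k, set to 0 at k = 0 because the drift fixes the last block;
     X k is the velocity of X (Suc k) under the drift. *)
  define X where "X k = (if k = 0 then 0 else x (n - k))" for k
  define E where "E s = action n (t + s) (\<lambda>i. x i - s * v i) y" for s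
  define H where "H s = 2 * boundary n (t + s) (\<lambda>i. x i - s * v i) y w - pint (t + s) (w * w)" for s
  have w: "w \<in> polys_below n" by (simp add: w_def minimiser_in_polys_below)
  have b: "((\<lambda>s. boundary n (t + s) (\<lambda>i. x i - s * v i) y w) has_real_derivative 0) (at 0)"
  proof -
    have "((\<lambda>s. boundary n (t + s) (\<lambda>i. x i - s * v i) y w) has_real_derivative
       (\<Sum>k<n. - (poly ((pderiv ^^ Suc k) w) t * X (Suc k) - poly ((pderiv ^^ k) w) t * X k))) (at 0)"
      unfolding boundary_def
    proof (intro DERIV_sum)
      fix k assume "k \<in> {..<n}"
      then have "v (n - Suc k) = X k" "X (Suc k) = x (n - Suc k)"
        by (auto simp: v_def X_def Suc_diff_Suc)
      then show "((\<lambda>s. poly ((pderiv ^^ k) w) 0 * y (n - Suc k)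
          - poly ((pderiv ^^ k) w) (t + s) * (x (n - Suc k) - s * v (n - Suc k))) has_real_derivative
          - (poly ((pderiv ^^ Suc k) w) t * X (Suc k) - poly ((pderiv ^^ k) w) t * X k)) (at 0)"
        by (auto intro!: derivative_eq_intros DERIV_chain2[OF poly_DERIV])
    qed
    also have "(\<Sum>k<n. - (poly ((pderiv ^^ Suc k) w) t * X (Suc k) - poly ((pderiv ^^ k) w) t * X k))
      = - (poly ((pderiv ^^ n) w) t * X n - poly ((pderiv ^^ 0) w) t * X 0)"
      unfolding sum_negf by (subst sum_lessThan_telescope) (rule refl)
    also have "\<dots> = 0" using w by (simp add: X_def polys_below_iff_higher_pderiv)
    finally show ?thesis .
  qed
  have dH: "(H has_real_derivative - (poly w t)\<^sup>2) (at 0)"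
    unfolding H_def
    by (rule DERIV_cong[OF DERIV_diff[OF DERIV_cmult[OF b] DERIV_pint[OF t]]]) (simp add: power2_eq_square)
  obtain D where D: "(E has_real_derivative D) (at 0)"
    using action_drift_differentiable[OF t, of n x v y] unfolding E_def field_differentiable_def by blast
  have "D - - (poly w t)\<^sup>2 = 0"
  proof (rule DERIV_local_min[OF DERIV_diff[OF D dH] t], intro allI impI)
    fix s assume "\<bar>0 - s\<bar> < t"
    then have "E s \<ge> H s"
      unfolding E_def H_def by (intro action_ge w) auto
    moreover have "E 0 = H 0"
      using t by (simp add: E_def H_def w_def boundary_minimiser pint_minimiser_sq)
    ultimately show "E 0 - H 0 \<le> E s - H s" by simp
  qed
  then have "D = - (poly w t)\<^sup>2" by simp
  then show ?thesis using D by (simp add: E_def[abs_def] w_def)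
qed

section \<open>Smoothness of the kernel\<close>

text \<open>A class of functions of time and space that contains the kernel and whose members have partial
  derivatives, for positive time, within the class. Being closed in this way is what yields
  smoothness of every order by induction.\<close>

inductive elementary :: "(real \<times> 'a::euclidean_space \<Rightarrow> real) \<Rightarrow> bool" where
  elementary_const: "elementary (\<lambda>z. c)"
| elementary_powr: "elementary (\<lambda>z. fst z powr r)"
| elementary_inverse: "elementary (\<lambda>z. inverse (fst z))"
| elementary_coord: "elementary (\<lambda>z. snd z \<bullet> b)"
| elementary_add: "elementary f \<Longrightarrow> elementary g \<Longrightarrow> elementary (\<lambda>z. f z + g z)"
| elementary_mult: "elementary f \<Longrightarrow> elementary g \<Longrightarrow> elementary (\<lambda>z. f z * g z)"
| elementary_exp: "elementary f \<Longrightarrow> elementary (\<lambda>z. exp (f z))"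

lemma elementary_sum: "(\<And>i. i \<in> I \<Longrightarrow> elementary (f i)) \<Longrightarrow> elementary (\<lambda>z. \<Sum>i\<in>I. f i z)"
  by (induction I rule: infinite_finite_induct)
    (simp_all add: elementary_const elementary_add)

lemma elementary_power: "elementary f \<Longrightarrow> elementary (\<lambda>z. f z ^ k)"
  by (induction k) (simp_all add: elementary_const elementary_mult)

lemma elementary_minus: "elementary f \<Longrightarrow> elementary (\<lambda>z. - f z)"
  using elementary_mult[OF elementary_const[of "-1"], of f] by simp

lemma elementary_diff: "elementary f \<Longrightarrow> elementary g \<Longrightarrow> elementary (\<lambda>z. f z - g z)"
  using elementary_add[OF _ elementary_minus, of f g] by simp

lemma elementary_divide_time: "elementary f \<Longrightarrow> elementary (\<lambda>z. f z / fst z)"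
  using elementary_mult[OF _ elementary_inverse, of f] by (simp add: divide_inverse)

lemma elementary_divide_const: "elementary f \<Longrightarrow> elementary (\<lambda>z. f z / c)"
  using elementary_mult[OF _ elementary_const[of "inverse c"], of f] by (simp add: divide_inverse)

lemma elementary_has_derivative:
  assumes "elementary f"
  shows "\<exists>f'. (\<forall>z. fst z > 0 \<longrightarrow> (f has_derivative f' z) (at z)) \<and> (\<forall>h. elementary (\<lambda>z. f' z h))"
  using assms
proof induction
  case (elementary_const c)
  show ?case
    by (rule exI[of _ "\<lambda>z h. 0"]) (auto intro: elementary.intros)
next
  case (elementary_powr r)
  show ?case
  proof (intro exI[of _ "\<lambda>z h. fst h * (r * fst z powr (r - 1))"] conjI allI impI)
    fix z :: "real \<times> 'a" assume "fst z > 0"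
    then show "((\<lambda>z. fst z powr r) has_derivative (\<lambda>h. fst h * (r * fst z powr (r - 1)))) (at z)"
      by (auto intro!: derivative_eq_intros simp: powr_diff)
  qed (intro elementary.intros)
next
  case elementary_inverse
  show ?case
    by (rule exI[of _ "\<lambda>z h. - fst h * (inverse (fst z) * inverse (fst z))"])
      (auto intro!: elementary.intros elementary_minus derivative_eq_intros)
next
  case (elementary_coord b)
  show ?case
    by (rule exI[of _ "\<lambda>z h. snd h \<bullet> b"]) (auto intro!: elementary.intros derivative_eq_intros)
next
  case (elementary_add f g)
  then obtain f' g' where
    "\<And>z. fst z > 0 \<Longrightarrow> (f has_derivative f' z) (at z)" "\<And>h. elementary (\<lambda>z. f' z h)"
    "\<And>z. fst z > 0 \<Longrightarrow> (g has_derivative g' z) (at z)" "\<And>h. elementary (\<lambda>z. g' z h)"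
    by blast
  then show ?case
    by (intro exI[of _ "\<lambda>z h. f' z h + g' z h"]) (auto intro!: elementary.intros derivative_intros)
next
  case (elementary_mult f g)
  then obtain f' g' where
    "\<And>z. fst z > 0 \<Longrightarrow> (f has_derivative f' z) (at z)" "\<And>h. elementary (\<lambda>z. f' z h)"
    "\<And>z. fst z > 0 \<Longrightarrow> (g has_derivative g' z) (at z)" "\<And>h. elementary (\<lambda>z. g' z h)"
    by blast
  then show ?case using elementary_mult.hyps
    by (intro exI[of _ "\<lambda>z h. f z * g' z h + f' z h * g z"]) (auto intro!: elementary.intros derivative_intros)
next
  case (elementary_exp f)
  then obtain f' where
    f': "\<And>z. fst z > 0 \<Longrightarrow> (f has_derivative f' z) (at z)" "\<And>h. elementary (\<lambda>z. f' z h)"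
    by blast
  then show ?case using elementary_exp.hyps
    by (intro exI[of _ "\<lambda>z h. exp (f z) * f' z h"])
      (auto intro!: elementary.intros derivative_eq_intros)
qed

lemma has_real_derivative_along_line:
  assumes "(f has_derivative f') (at z)"
  shows "((\<lambda>s. f (z + s *\<^sub>R b)) has_real_derivative f' b) (at 0)"
proof -
  have "((\<lambda>s. z + s *\<^sub>R b) has_derivative (\<lambda>s. s *\<^sub>R b)) (at 0)"
    by (auto intro!: derivative_eq_intros)
  then have "((\<lambda>s. f (z + s *\<^sub>R b)) has_derivative (\<lambda>s. f' (s *\<^sub>R b))) (at 0)"
    by (rule has_derivative_compose) (use assms in simp)
  moreover have "f' (s *\<^sub>R b) = f' b * s" for s
    using linear_scale[OF has_derivative_linear[OF assms]] by simp
  ultimately show ?thesis by (simp add: has_field_derivative_def)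
qed

lemma partial_deriv_eqI: "(f has_derivative f') (at z) \<Longrightarrow> partial_deriv b f z = f' b"
  unfolding partial_deriv_def by (intro DERIV_imp_deriv has_real_derivative_along_line)

text \<open>Partial derivatives depend only on the values near a point, so openness of \<open>U\<close> is essential.\<close>

lemma Ck_on_cong:
  assumes "open U" "\<And>z. z \<in> U \<Longrightarrow> f z = g z"
  shows "Ck_on k U f \<longleftrightarrow> Ck_on k U g"
  using assms(2)
proof (induction k arbitrary: f g)
  case 0
  then show ?case by (auto intro: continuous_on_cong[THEN iffD1])
next
  case (Suc k)
  have "partial_deriv b f z = partial_deriv b g z" if "z \<in> U" for b z
  proof -
    have "((\<lambda>s. z + s *\<^sub>R b) \<longlongrightarrow> z) (nhds 0)"
      by (rule tendsto_eq_intros refl filterlim_ident | simp)+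
    then have "eventually (\<lambda>s. z + s *\<^sub>R b \<in> U) (nhds 0)"
      using assms(1) that by (rule topological_tendstoD)
    then have "eventually (\<lambda>s. f (z + s *\<^sub>R b) = g (z + s *\<^sub>R b)) (nhds 0)"
      by eventually_elim (rule Suc.prems)
    then show ?thesis unfolding partial_deriv_def by (rule deriv_cong_ev) simp
  qed
  then have "Ck_on k U (partial_deriv b f) \<longleftrightarrow> Ck_on k U (partial_deriv b g)" for b
    by (rule Suc.IH)
  moreover have "f differentiable_on U \<longleftrightarrow> g differentiable_on U"
    unfolding differentiable_on_def differentiable_def
    using has_derivative_transform[of _ U f g] has_derivative_transform[of _ U g f] Suc.prems
    by (metis (no_types, lifting))
  ultimately show ?case by simp
qed

lemma open_time_space: "open ({0<..} \<times> UNIV :: (real \<times> 'a::euclidean_space) set)"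
  by (intro open_Times) auto

lemma elementary_Ck_on: "elementary f \<Longrightarrow> Ck_on k ({0<..} \<times> UNIV) f"
proof (induction k arbitrary: f)
  case 0
  obtain f' where f': "\<And>z. fst z > 0 \<Longrightarrow> (f has_derivative f' z) (at z)"
    using elementary_has_derivative[OF 0] by blast
  have "continuous_on ({0<..} \<times> UNIV) f"
    by (intro continuous_at_imp_continuous_on ballI) (auto intro: has_derivative_continuous[OF f'])
  then show ?case by simp
next
  case (Suc k)
  obtain f' where f': "\<And>z. fst z > 0 \<Longrightarrow> (f has_derivative f' z) (at z)"
    and el: "\<And>h. elementary (\<lambda>z. f' z h)"
    using elementary_has_derivative[OF Suc.prems] by blast
  have "f differentiable_on ({0<..} \<times> UNIV)"
    unfolding differentiable_on_def
    by (auto intro!: differentiableI[OF has_derivative_at_withinI[OF f']])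
  moreover have "Ck_on k ({0<..} \<times> UNIV) (partial_deriv b f)" for b
  proof -
    have "Ck_on k ({0<..} \<times> UNIV) (partial_deriv b f) \<longleftrightarrow> Ck_on k ({0<..} \<times> UNIV) (\<lambda>z. f' z b)"
      by (intro Ck_on_cong open_time_space partial_deriv_eqI f') auto
    then show ?thesis using Suc.IH[OF el] by simp
  qed
  ultimately show ?case by simp
qed

lemma elementary_coords: "elementary (\<lambda>z. coords (snd z) j i)"
  using elementary_coord[of "axis (ith (Suc i)) (axis j (1::real))"]
  by (simp add: coords_def block_def inner_axis inner_real_def)

text \<open>The kernel as a function of time and space jointly, with the infimum over paths replaced by its
  value. It coincides with \<open>kernel\<close> for positive time.\<close>

definition smooth_kernel :: "real \<Rightarrow> ('d::finite, 'n::{finite,linorder}) points \<Rightarrow> real \<times> ('d, 'n) points \<Rightarrow> real" where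
  "smooth_kernel \<beta> y z = \<beta> * fst z powr - (real (CARD('n)\<^sup>2 * CARD('d)) / 2) * exp (- total_action (fst z) (snd z) y / 4)"

lemma elementary_smooth_kernel: "elementary (smooth_kernel \<beta> y)"
  unfolding smooth_kernel_def[abs_def] total_action_def action_def legendre_coeff_def
  by (intro elementary_sum elementary_power elementary_coords elementary_divide_time
     elementary_divide_const elementary_minus elementary_diff elementary.intros)

section \<open>The Kolmogorov equation\<close>

text \<open>Avoids any reference to the components of the gradient: only its pairings with vectors occur in
  the equation.\<close>

lemma inner_gradient:
  fixes g :: "'a::euclidean_space \<Rightarrow> real"
  assumes "(g has_derivative g') (at v)"
  shows "u \<bullet> gradient g v = g' u"
proof -
  define D where "D = (\<Sum>b\<in>Basis. g' b *\<^sub>R b)"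
  interpret linear g' using assms by (rule has_derivative_linear)
  have g': "g' u = u \<bullet> D" for u
  proof -
    have "g' u = g' (\<Sum>b\<in>Basis. (u \<bullet> b) *\<^sub>R b)" by (simp add: euclidean_representation)
    also have "\<dots> = u \<bullet> D" by (simp add: sum scale D_def inner_sum_right mult.commute)
    finally show ?thesis .
  qed
  then have D: "GDERIV g v :> D"
    using assms by (simp add: gderiv_def flip: g')
  have "D' = D" if "GDERIV g v :> D'" for D'
  proof -
    have "(\<lambda>h. h \<bullet> D') = (\<lambda>h. h \<bullet> D)"
      using that D unfolding gderiv_def by (rule has_derivative_unique)
    then show ?thesis by (metis vector_eq_ldot)
  qed
  then have "gradient g v = D" unfolding gradient_def using D by (rule the_equality[rotated])
  then show ?thesis by (simp add: g')
qed

lemma partial_deriv_twice_eqI: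
  assumes "\<And>s. ((\<lambda>s. g (v + s *\<^sub>R b)) has_real_derivative h s) (at s)"
    and "(h has_real_derivative h') (at 0)"
  shows "partial_deriv b (partial_deriv b g) v = h'"
proof -
  have "partial_deriv b g (v + s *\<^sub>R b) = h s" for s
  proof -
    have "((\<lambda>r. g (v + (s + r) *\<^sub>R b)) has_real_derivative h s) (at 0)"
      using assms(1)[of s] by (simp add: DERIV_shift[of _ _ 0 s, simplified] add.commute)
    then show ?thesis
      unfolding partial_deriv_def by (intro DERIV_imp_deriv) (simp add: scaleR_add_left add.assoc)
  qed
  then show ?thesis
    unfolding partial_deriv_def[of b "partial_deriv b g"] using assms(2) by (simp add: DERIV_imp_deriv)
qed

lemma laplacian_vec:
  fixes g :: "real^'d::finite \<Rightarrow> real"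
  shows "laplacian g v = (\<Sum>j\<in>UNIV. partial_deriv (axis j 1) (partial_deriv (axis j 1) g) v)"
proof -
  have B: "(Basis :: (real^'d) set) = range (\<lambda>j. axis j 1)"
    by (auto simp: Basis_vec_def)
  have "inj (\<lambda>j. axis j 1 :: real^'d)"
    by (auto simp: inj_def axis_eq_axis)
  then show ?thesis unfolding laplacian_def B by (simp add: sum.reindex)
qed

lemma set_block_eq: "set_block x k v = x + axis (ith k) (v - block x k)"
  for x :: "('d::finite, 'n::{finite,linorder}) points"
  by (auto simp: set_block_def vec_eq_iff axis_def block_def)

lemma bounded_linear_axis: "bounded_linear (axis i :: 'a::euclidean_space \<Rightarrow> 'a^'n::finite)"
  unfolding linear_conv_bounded_linear[symmetric]
  by (rule linearI) (auto simp: vec_eq_iff axis_def)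

lemma coords_set_block_last:
  fixes x :: "('d::finite, 'n::{finite,linorder}) points"
  assumes "i < CARD('n)"
  shows "coords (set_block x CARD('n) (block x CARD('n) + s *\<^sub>R axis j 1)) j' i =
    (if j' = j \<and> i = CARD('n) - 1 then coords x j' i + s else coords x j' i)"
proof -
  have "ith (Suc i) = (ith CARD('n) :: 'n) \<longleftrightarrow> i = CARD('n) - 1"
    using assms by (subst ith_eq_iff) auto
  moreover have "Suc (CARD('n) - 1) = CARD('n)" using assms by simp
  ultimately show ?thesis
    using assms by (auto simp: coords_def set_block_def block_def axis_def)
qed

text \<open>The coordinates of \<open>\<real>\<^sup>d\<close> decouple: a shift in direction \<open>j\<close> changes the \<open>j\<close>-th action only.\<close>

lemma total_action_set_block_last:
  fixes x y :: "('d::finite, 'n::{finite,linorder}) points"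
  assumes "t > 0"
  shows "total_action t (set_block x CARD('n) (block x CARD('n) + s *\<^sub>R axis j 1)) y
    = total_action t x y - 2 * s * poly (minimiser CARD('n) t (coords x j) (coords y j)) t
        + s\<^sup>2 * (real CARD('n))\<^sup>2 / t"
proof -
  let ?x = "set_block x CARD('n) (block x CARD('n) + s *\<^sub>R axis j 1)"
  let ?w = "poly (minimiser CARD('n) t (coords x j) (coords y j)) t"
  have "action CARD('n) t (coords ?x j') (coords y j') = action CARD('n) t (coords x j') (coords y j')
      + (if j' = j then - 2 * s * ?w + s\<^sup>2 * (real CARD('n))\<^sup>2 / t else 0)" for j'
  proof (cases "j' = j")
    case True
    have "action CARD('n) t (coords ?x j) (coords y j) =
        action CARD('n) t (\<lambda>i. if i = CARD('n) - 1 then coords x j i + s else coords x j i) (coords y j)"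
      by (rule action_cong) (simp_all add: coords_set_block_last)
    then show ?thesis
      using assms True by (subst (asm) action_shift_last) simp_all
  next
    case False
    have "action CARD('n) t (coords ?x j') (coords y j') = action CARD('n) t (coords x j') (coords y j')"
      by (rule action_cong) (simp_all add: coords_set_block_last False)
    then show ?thesis using False by simp
  qed
  then show ?thesis by (simp add: total_action_def sum.distrib)
qed

text \<open>In each coordinate direction of the last block the kernel is the exponential of a quadratic
  polynomial in the shift \<open>s\<close>, by \<open>total_action_set_block_last\<close>.\<close>

lemma laplacian_smooth_kernel:
  fixes x y :: "('d::finite, 'n::{finite,linorder}) points"
  assumes t: "t > 0"
  shows "laplacian_block CARD('n) (\<lambda>x. smooth_kernel \<beta> y (t, x)) x = smooth_kernel \<beta> y (t, x) *
    ((\<Sum>j\<in>UNIV. (poly (minimiser CARD('n) t (coords x j) (coords y j)) t)\<^sup>2) / 4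
       - real (CARD('n)\<^sup>2 * CARD('d)) / (2 * t))"
proof -
  define F where "F = smooth_kernel \<beta> y (t, x)"
  define w where "w j = poly (minimiser CARD('n) t (coords x j) (coords y j)) t" for j
  define a where "a = (real CARD('n))\<^sup>2 / t"
  let ?g = "\<lambda>v. smooth_kernel \<beta> y (t, set_block x CARD('n) v)"
  have "partial_deriv (axis j 1) (partial_deriv (axis j 1) ?g) (block x CARD('n))
      = F * ((w j)\<^sup>2 / 4 - a / 2)" for j
  proof (rule partial_deriv_twice_eqI)
    have *: "(\<lambda>s. ?g (block x CARD('n) + s *\<^sub>R axis j 1)) = (\<lambda>s. F * exp ((2 * s * w j - s\<^sup>2 * a) / 4))"
      using t by (simp add: smooth_kernel_def total_action_set_block_last F_def w_def a_def fun_eq_iff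
        flip: exp_add)
    show "((\<lambda>s. ?g (block x CARD('n) + s *\<^sub>R axis j 1)) has_real_derivative
        F * exp ((2 * s * w j - s\<^sup>2 * a) / 4) * (w j / 2 - s * a / 2)) (at s)" for s
      unfolding * by (auto intro!: derivative_eq_intros simp: field_simps)
    show "((\<lambda>s. F * exp ((2 * s * w j - s\<^sup>2 * a) / 4) * (w j / 2 - s * a / 2)) has_real_derivative
        F * ((w j)\<^sup>2 / 4 - a / 2)) (at 0)"
      by (auto intro!: derivative_eq_intros simp: field_simps power2_eq_square)
  qed
  then have "laplacian_block CARD('n) (\<lambda>x. smooth_kernel \<beta> y (t, x)) x = (\<Sum>j\<in>UNIV. F * ((w j)\<^sup>2 / 4 - a / 2))"
    unfolding laplacian_block_def laplacian_vec by simp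
  also have "\<dots> = F * ((\<Sum>j\<in>UNIV. (w j)\<^sup>2) / 4 - real (CARD('n)\<^sup>2 * CARD('d)) / (2 * t))"
    using t by (simp add: sum_subtractf a_def field_simps flip: sum_distrib_left sum_divide_distrib)
  finally show ?thesis by (simp add: F_def w_def)
qed

text \<open>The first-order part of the equation is the derivative in the direction of this vector, whose
  blocks are \<open>x\<^sub>2, \<dots>, x\<^sub>n, 0\<close>.\<close>

definition drift :: "('d::finite, 'n::{finite,linorder}) points \<Rightarrow> ('d, 'n) points" where
  "drift x = (\<Sum>i=2..CARD('n). axis (ith (i - 1)) (block x i))"

lemma coords_drift:
  fixes x :: "('d::finite, 'n::{finite,linorder}) points"
  assumes "i < CARD('n)"
  shows "coords (drift x) j i = (if Suc i < CARD('n) then coords x j (Suc i) else 0)"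
proof -
  have "coords (drift x) j i = (\<Sum>l=2..CARD('n). (if ith (l - 1) = (ith (Suc i) :: 'n) then block x l $ j else 0))"
    by (auto simp: coords_def drift_def block_def axis_def intro!: sum.cong)
  also have "\<dots> = (\<Sum>l=2..CARD('n). (if l = Suc (Suc i) then coords x j (Suc i) else 0))"
  proof (rule sum.cong)
    fix l assume "l \<in> {2..CARD('n)}"
    then have "ith (l - 1) = (ith (Suc i) :: 'n) \<longleftrightarrow> l = Suc (Suc i)"
      using assms by (subst ith_eq_iff) auto
    then show "(if ith (l - 1) = (ith (Suc i) :: 'n) then block x l $ j else 0) =
        (if l = Suc (Suc i) then coords x j (Suc i) else 0)"
      by (simp add: coords_def)
  qed simp
  also have "\<dots> = (if Suc i < CARD('n) then coords x j (Suc i) else 0)"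
    by auto
  finally show ?thesis .
qed

text \<open>The right-hand side is the same as in \<open>laplacian_smooth_kernel\<close>. The term with \<open>n\<^sup>2 * d\<close> comes
  from the power of \<open>t\<close> in front of the exponential here, and from the second derivative of the
  action there.\<close>

lemma smooth_kernel_drift:
  fixes x y :: "('d::finite, 'n::{finite,linorder}) points"
  assumes t: "t > 0"
  shows "((\<lambda>s. smooth_kernel \<beta> y (t + s, x - s *\<^sub>R drift x)) has_real_derivative smooth_kernel \<beta> y (t, x) *
    ((\<Sum>j\<in>UNIV. (poly (minimiser CARD('n) t (coords x j) (coords y j)) t)\<^sup>2) / 4
       - real (CARD('n)\<^sup>2 * CARD('d)) / (2 * t))) (at 0)"
proof -
  define w where "w j = poly (minimiser CARD('n) t (coords x j) (coords y j)) t" for j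
  define a where "a = real (CARD('n)\<^sup>2 * CARD('d)) / 2"
  define A where "A s = total_action (t + s) (x - s *\<^sub>R drift x) y" for s
  have "A = (\<lambda>s. \<Sum>j\<in>UNIV. action CARD('n) (t + s) (\<lambda>i. coords x j i - s *
      (if Suc i < CARD('n) then coords x j (Suc i) else 0)) (coords y j))"
    unfolding A_def total_action_def
  proof (intro ext sum.cong refl action_cong)
    fix s :: real and j i assume "i < CARD('n)"
    from coords_drift[OF this, of x j]
    show "coords (x - s *\<^sub>R drift x) j i = coords x j i - s *
      (if Suc i < CARD('n) then coords x j (Suc i) else 0)"
      by (simp add: coords_def block_def)
  qed
  then have dA: "(A has_real_derivative (\<Sum>j\<in>UNIV. - (w j)\<^sup>2)) (at 0)"
    unfolding w_def by (simp only:) (intro DERIV_sum DERIV_action_drift t)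
  have "((\<lambda>s. \<beta> * (t + s) powr - a * exp (- A s / 4)) has_real_derivative
     \<beta> * (t powr - a) * exp (- A 0 / 4) * ((\<Sum>j\<in>UNIV. (w j)\<^sup>2) / 4 - a / t)) (at 0)"
    using t by (auto intro!: derivative_eq_intros dA simp: sum_negf powr_diff field_simps)
  then show ?thesis
    by (simp add: smooth_kernel_def A_def a_def w_def)
qed

lemma inner_gradient_block:
  fixes x :: "('d::finite, 'n::{finite,linorder}) points"
  assumes F: "(F has_derivative F') (at (t, x))"
  shows "u \<bullet> gradient_block k (\<lambda>x. F (t, x)) x = F' (0, axis (ith k) u)"
proof -
  have "((\<lambda>v. (t, set_block x k v)) has_derivative (\<lambda>h. (0, axis (ith k) h))) (at (block x k))"
    unfolding set_block_eq
    by (auto intro!: derivative_eq_intros bounded_linear.has_derivative[OF bounded_linear_axis])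
  moreover have "(F has_derivative F') (at (t, set_block x k (block x k)))"
    using F by (simp add: set_block_eq axis_def zero_vec_def[symmetric] flip: vec_eq_iff)
  ultimately have "((\<lambda>v. F (t, set_block x k v)) has_derivative (\<lambda>h. F' (0, axis (ith k) h))) (at (block x k))"
    by (rule has_derivative_compose)
  then show ?thesis unfolding gradient_block_def by (rule inner_gradient)
qed

lemma kernel_eq_smooth_kernel: "t > 0 \<Longrightarrow> kernel \<beta> t x y = smooth_kernel \<beta> y (t, x)"
  by (simp add: kernel_eq smooth_kernel_def)

text \<open>The time derivative minus the drift term is the Frechet derivative in the single direction
  \<open>(1, - drift x)\<close>, which \<open>smooth_kernel_drift\<close> computes.\<close>

lemma kolmogorov_solution_kernel:
  fixes y :: "('d::finite, 'n::{finite,linorder}) points"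
  shows "kolmogorov_solution (\<lambda>t x. kernel \<beta> t x y)"
  unfolding kolmogorov_solution_def
proof (intro conjI allI impI)
  have "Ck_on 2 ({0<..} \<times> UNIV) (\<lambda>(t, x). kernel \<beta> t x y) \<longleftrightarrow> Ck_on 2 ({0<..} \<times> UNIV) (smooth_kernel \<beta> y)"
    by (rule Ck_on_cong[OF open_time_space]) (auto simp: kernel_eq_smooth_kernel)
  then show "Ck_on 2 ({0<..} \<times> UNIV) (\<lambda>(t, x). kernel \<beta> t x y)"
    by (simp only: elementary_Ck_on elementary_smooth_kernel)
next
  fix t :: real and x :: "('d, 'n) points" assume t: "t > 0"
  define F where "F = smooth_kernel \<beta> y"
  obtain F' where F': "(F has_derivative F') (at (t, x))"
    using elementary_has_derivative[OF elementary_smooth_kernel, of \<beta> y] t unfolding F_def by force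
  interpret F': linear F' using F' by (rule has_derivative_linear)
  define R where "R = F (t, x) *
    ((\<Sum>j\<in>UNIV. (poly (minimiser CARD('n) t (coords x j) (coords y j)) t)\<^sup>2) / 4
       - real (CARD('n)\<^sup>2 * CARD('d)) / (2 * t))"
  have "deriv (\<lambda>s. kernel \<beta> s x y) t = F' (1, 0)"
  proof -
    have "eventually (\<lambda>s. s \<in> {0<..}) (nhds t)"
      using t by (intro eventually_nhds_in_open) auto
    then have "deriv (\<lambda>s. kernel \<beta> s x y) t = deriv (\<lambda>s. F (s, x)) t"
      unfolding F_def by (intro deriv_cong_ev refl) (auto elim!: eventually_mono simp: kernel_eq_smooth_kernel)
    also have "deriv (\<lambda>s. F (s, x)) t = F' (1, 0)"
    proof (rule DERIV_imp_deriv)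
      have "((\<lambda>s. F (s, x)) has_derivative (\<lambda>h. F' (h, 0))) (at t)"
        by (rule has_derivative_compose[of "\<lambda>s. (s, x)" "\<lambda>h. (h, 0)", OF _ F'])
          (auto intro!: derivative_eq_intros)
      moreover have "(\<lambda>h. F' (h, 0)) = (*) (F' (1, 0))"
      proof
        show "F' (h, 0) = F' (1, 0) * h" for h
          using F'.scale[of h "(1, 0)"] by simp
      qed
      ultimately show "((\<lambda>s. F (s, x)) has_real_derivative F' (1, 0)) (at t)"
        by (simp add: has_field_derivative_def)
    qed
    finally show ?thesis .
  qed
  moreover have "(\<Sum>i=2..CARD('n). block x i \<bullet> gradient_block (i - 1) (\<lambda>x. kernel \<beta> t x y) x) = F' (0, drift x)"
  proof -
    have "(\<Sum>i=2..CARD('n). block x i \<bullet> gradient_block (i - 1) (\<lambda>x. kernel \<beta> t x y) x)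
        = (\<Sum>i=2..CARD('n). F' (0, axis (ith (i - 1)) (block x i)))"
      unfolding kernel_eq_smooth_kernel[OF t] F_def[symmetric] inner_gradient_block[OF F'] ..
    also have "\<dots> = F' (\<Sum>i=2..CARD('n). (0, axis (ith (i - 1)) (block x i)))"
      by (rule F'.sum[symmetric])
    also have "(\<Sum>i=2..CARD('n). (0, axis (ith (i - 1)) (block x i))) = (0 :: real, drift x)"
      by (simp add: prod_eq_iff fst_sum snd_sum drift_def)
    finally show ?thesis .
  qed
  moreover have "laplacian_block CARD('n) (\<lambda>x. kernel \<beta> t x y) x = R"
    unfolding kernel_eq_smooth_kernel[OF t] laplacian_smooth_kernel[OF t] R_def F_def ..
  moreover have "F' (1, 0) - F' (0, drift x) = R"
  proof -
    have "((\<lambda>s. F (t + s, x - s *\<^sub>R drift x)) has_real_derivative F' (1, - drift x)) (at 0)"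
      using has_real_derivative_along_line[OF F', of "(1, - drift x)"] by simp
    moreover have "((\<lambda>s. F (t + s, x - s *\<^sub>R drift x)) has_real_derivative R) (at 0)"
      unfolding F_def R_def by (rule smooth_kernel_drift[OF t])
    ultimately have "F' (1, - drift x) = R" by (rule DERIV_unique)
    then show ?thesis using F'.diff[of "(1, 0)" "(0, drift x)"] by simp
  qed
  ultimately show "deriv (\<lambda>s. kernel \<beta> s x y) t =
    (\<Sum>i=2..CARD('n). block x i \<bullet> gradient_block (i - 1) (\<lambda>x. kernel \<beta> t x y) x)
     + laplacian_block CARD('n) (\<lambda>x. kernel \<beta> t x y) x"
    by simp
qed

section \<open>Normalisation and the initial condition\<close>

definition jet_poly :: "nat \<Rightarrow> (nat \<Rightarrow> real) \<Rightarrow> real poly" where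
  "jet_poly n y = (SOME p. (pderiv ^^ n) p = 0 \<and> (\<forall>i<n. poly ((pderiv ^^ i) p) 0 = y i))"

lemma jet_poly:
  "(pderiv ^^ n) (jet_poly n y) = 0"
  "i < n \<Longrightarrow> poly ((pderiv ^^ i) (jet_poly n y)) 0 = y i"
  using someI_ex[OF ex_poly_with_jet[of n 0 0 y], folded jet_poly_def] by auto

text \<open>The starting point from which the motion with vanishing \<open>n\<close>-th derivative reaches \<open>y\<close> at time \<open>t\<close>:
  follow the polynomial with derivatives \<open>y\<close> at time \<open>0\<close> back to time \<open>- t\<close>.\<close>

definition free_flow :: "real \<Rightarrow> ('d::finite, 'n::{finite,linorder}) points \<Rightarrow> ('d, 'n) points" where
  "free_flow t y = (\<chi> i. \<chi> j. poly ((pderiv ^^ (card {..i} - 1)) (jet_poly CARD('n) (coords y j))) (- t))"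

lemma coords_free_flow:
  fixes y :: "('d::finite, 'n::{finite,linorder}) points"
  assumes "i < CARD('n)"
  shows "coords (free_flow t y) j i = poly ((pderiv ^^ i) (jet_poly CARD('n) (coords y j))) (- t)"
  using assms by (simp add: coords_def free_flow_def block_def card_atMost_ith)

lemma coords_eqI:
  fixes x y :: "('d::finite, 'n::{finite,linorder}) points"
  assumes "\<And>j i. i < CARD('n) \<Longrightarrow> coords x j i = coords y j i"
  shows "x = y"
proof -
  have "x $ i $ j = y $ i $ j" for i j
  proof -
    obtain k where "k < CARD('n)" "i = ith (Suc k)"
      using bij_betw_imp_surj_on[OF bij_betw_ith[where 'n='n]] by blast
    then show ?thesis using assms[of k j] by (simp add: coords_def block_def)
  qed
  then show ?thesis by (simp add: vec_eq_iff)
qed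

text \<open>Integrate by parts along the polynomial path, whose \<open>n\<close>-th derivative vanishes.\<close>

lemma boundary_free_flow:
  assumes t: "t > 0" and q: "q \<in> polys_below n"
  shows "boundary n t (\<lambda>i. poly ((pderiv ^^ i) (jet_poly n y)) (- t)) y q = 0"
proof -
  define D where "D i s = poly ((pderiv ^^ i) (jet_poly n y)) (s - t)" for i s
  have "((\<lambda>s. poly q (t - s) * D n s) has_integral
      boundary n t (\<lambda>i. D i 0) (\<lambda>i. D i t) q) {0..t}"
  proof (rule has_integral_boundary[OF less_imp_le[OF t] q])
    fix i s
    have "(D i has_real_derivative D (Suc i) s) (at s within {0..t})"
      unfolding D_def by (rule derivative_eq_intros DERIV_chain2[OF poly_DERIV] refl)+ simp
    then show "(D i has_vector_derivative D (Suc i) s) (at s within {0..t})"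
      by (simp add: has_real_derivative_iff_has_vector_derivative)
  qed
  then have "((\<lambda>s. 0) has_integral boundary n t (\<lambda>i. D i 0) (\<lambda>i. D i t) q) {0..t}"
    by (simp add: D_def jet_poly)
  then have "boundary n t (\<lambda>i. D i 0) (\<lambda>i. D i t) q = 0"
    by (rule has_integral_unique[OF _ has_integral_0])
  also have "boundary n t (\<lambda>i. D i 0) (\<lambda>i. D i t) q
      = boundary n t (\<lambda>i. poly ((pderiv ^^ i) (jet_poly n y)) (- t)) y q"
    unfolding boundary_def by (intro sum.cong refl) (simp add: D_def jet_poly)
  finally show ?thesis .
qed

lemma total_action_free_flow:
  fixes y z :: "('d::finite, 'n::{finite,linorder}) points"
  assumes t: "t > 0"
  shows "total_action t (free_flow t y + z) y = total_action t z 0"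
  unfolding total_action_def
proof (intro sum.cong refl)
  fix j
  have "legendre_coeff CARD('n) t (coords (free_flow t y + z) j) (coords y j) m
      = legendre_coeff CARD('n) t (coords z j) (coords (0 :: ('d, 'n) points) j) m" if "m < CARD('n)" for m
  proof -
    let ?q = "pcompose (legendre m) [:0, 1 / t:]"
    let ?p = "\<lambda>i. poly ((pderiv ^^ i) (jet_poly CARD('n) (coords y j))) (- t)"
    have "boundary CARD('n) t (coords (free_flow t y + z) j) (coords y j) ?q
        = boundary CARD('n) t ?p (coords y j) ?q + boundary CARD('n) t (coords z j) (coords (0 :: ('d, 'n) points) j) ?q"
      unfolding boundary_def sum.distrib[symmetric]
    proof (intro sum.cong refl)
      fix k assume "k \<in> {..<CARD('n)}"
      then have "coords (free_flow t y + z) j (CARD('n) - Suc k) = ?p (CARD('n) - Suc k) + coords z j (CARD('n) - Suc k)"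
        "coords (0 :: ('d, 'n) points) j (CARD('n) - Suc k) = 0"
        using coords_free_flow[of "CARD('n) - Suc k" t y j] by (simp_all add: coords_def block_def)
      then show "poly ((pderiv ^^ k) ?q) 0 * coords y j (CARD('n) - Suc k) -
          poly ((pderiv ^^ k) ?q) t * coords (free_flow t y + z) j (CARD('n) - Suc k) =
          (poly ((pderiv ^^ k) ?q) 0 * coords y j (CARD('n) - Suc k) -
          poly ((pderiv ^^ k) ?q) t * ?p (CARD('n) - Suc k)) +
          (poly ((pderiv ^^ k) ?q) 0 * coords (0 :: ('d, 'n) points) j (CARD('n) - Suc k) -
          poly ((pderiv ^^ k) ?q) t * coords z j (CARD('n) - Suc k))"
        by (simp only:) (simp add: algebra_simps)
    qed
    also have "boundary CARD('n) t ?p (coords y j) ?q = 0"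
      using that by (intro boundary_free_flow[OF t] pcompose_linear_in_polys_below legendre_in_polys_below)
    finally show ?thesis using t by (simp add: boundary_rescaled_legendre)
  qed
  then show "action CARD('n) t (coords (free_flow t y + z) j) (coords y j)
      = action CARD('n) t (coords z j) (coords (0 :: ('d, 'n) points) j)"
    by (simp add: action_def)
qed

text \<open>Block \<open>n - k\<close> is multiplied by \<open>t powr (k + 1 / 2)\<close>, its size when a path of unit action runs for
  time \<open>t\<close>.\<close>

definition rescale :: "real \<Rightarrow> ('d::finite, 'n::{finite,linorder}) points \<Rightarrow> ('d, 'n) points" where
  "rescale t z = (\<chi> i. t powr (real CARD('n) - real (card {..i}) + 1 / 2) *\<^sub>R z $ i)"

lemma linear_rescale: "linear (rescale t)"
  by (rule linearI) (auto simp: rescale_def vec_eq_iff algebra_simps)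

lemma coords_rescale:
  fixes z :: "('d::finite, 'n::{finite,linorder}) points"
  assumes "t > 0" "k < CARD('n)"
  shows "coords (rescale t z) j (CARD('n) - Suc k) = t ^ k * sqrt t * coords z j (CARD('n) - Suc k)"
proof -
  have "card {..ith (Suc (CARD('n) - Suc k)) :: 'n} = CARD('n) - k"
    using assms by (subst card_atMost_ith) auto
  then have "coords (rescale t z) j (CARD('n) - Suc k)
      = t powr (real k + 1 / 2) * coords z j (CARD('n) - Suc k)"
    using assms by (simp add: coords_def block_def rescale_def of_nat_diff)
  then show ?thesis
    using assms by (simp add: powr_add powr_realpow powr_half_sqrt)
qed

lemma coords_0 [simp]: "coords 0 j i = 0"
  by (simp add: coords_def block_def)

lemma total_action_rescale:
  fixes z :: "('d::finite, 'n::{finite,linorder}) points"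
  assumes t: "t > 0"
  shows "total_action t (rescale t z) 0 = total_action 1 z 0"
proof -
  have "legendre_coeff CARD('n) t (coords (rescale t z) j) (coords (0 :: ('d, 'n) points) j) m
      = sqrt t * legendre_coeff CARD('n) 1 (coords z j) (coords (0 :: ('d, 'n) points) j) m" for j m
    unfolding legendre_coeff_def sum_distrib_left using t
    by (intro sum.cong refl) (simp add: coords_rescale power_one_over field_simps)
  then show ?thesis
    using t by (simp add: total_action_def action_def power_mult_distrib flip: sum_distrib_left)
qed

text \<open>The exponential factor of the kernel at \<open>t = 1\<close>, \<open>y = 0\<close>.\<close>

definition gauss :: "('d::finite, 'n::{finite,linorder}) points \<Rightarrow> real" where
  "gauss z = exp (- total_action 1 z 0 / 4)"

lemma continuous_smooth_kernel:
  assumes "t > 0"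
  shows "continuous_on UNIV (\<lambda>x. smooth_kernel \<beta> y (t, x))"
proof -
  have "continuous_on ({0<..} \<times> UNIV) (smooth_kernel \<beta> y)"
    using elementary_Ck_on[OF elementary_smooth_kernel, of 0] by simp
  then show ?thesis
    by (rule continuous_on_compose2) (use assms in \<open>auto intro!: continuous_intros\<close>)
qed

lemma gauss_eq: "gauss = (\<lambda>x. smooth_kernel 1 0 (1, x))"
  by (auto simp: gauss_def smooth_kernel_def)

lemma continuous_gauss: "continuous_on UNIV gauss"
  unfolding gauss_eq by (intro continuous_smooth_kernel) simp

lemma measurable_gauss [measurable]: "gauss \<in> borel_measurable borel"
  by (intro borel_measurable_continuous_onI continuous_gauss)

lemma gauss_pos: "gauss z > 0"
  by (simp add: gauss_def)

lemma total_action_scaleR: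
  fixes z :: "('d::finite, 'n::{finite,linorder}) points"
  shows "total_action 1 (c *\<^sub>R z) 0 = c\<^sup>2 * total_action 1 z 0"
proof -
  have "legendre_coeff n 1 (coords (c *\<^sub>R z) j) (coords (0 :: ('d, 'n) points) j) m
      = c * legendre_coeff n 1 (coords z j) (coords (0 :: ('d, 'n) points) j) m" for n j m
    unfolding legendre_coeff_def sum_distrib_left
    by (intro sum.cong refl) (simp add: coords_def block_def)
  then show ?thesis
    by (simp add: total_action_def action_def power_mult_distrib sum_distrib_left)
qed

text \<open>If the action vanishes then so do the minimiser and hence \<open>boundary\<close> on all polynomials of
  degree below \<open>n\<close>, which determines the initial data.\<close>

lemma total_action_pos:
  fixes z :: "('d::finite, 'n::{finite,linorder}) points"
  assumes "z \<noteq> 0"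
  shows "total_action 1 z 0 > 0"
proof (rule ccontr)
  assume "\<not> total_action 1 z 0 > 0"
  moreover have nonneg: "action CARD('n) 1 (coords z j) (coords (0 :: ('d, 'n) points) j) \<ge> 0" for j
    by (simp add: action_nonneg)
  then have "total_action 1 z 0 \<ge> 0" unfolding total_action_def by (rule sum_nonneg)
  ultimately have "total_action 1 z 0 = 0" by simp
  then have 0: "action CARD('n) 1 (coords z j) (coords (0 :: ('d, 'n) points) j) = 0" for j
    unfolding total_action_def using nonneg by (simp add: sum_nonneg_eq_0_iff)
  have "coords z j i = 0" if "i < CARD('n)" for i j
  proof (rule boundary_eq_0_imp(2)[where y = "coords (0 :: ('d, 'n) points) j" and t = 1, OF _ _ that])
    fix q assume "q \<in> polys_below CARD('n)"
    moreover have "minimiser CARD('n) 1 (coords z j) (coords (0 :: ('d, 'n) points) j) = 0"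
      using pint_minimiser_sq[of 1 "CARD('n)" "coords z j" "coords (0 :: ('d, 'n) points) j"] 0[of j]
      by (intro pint_square_eq_0[of 1]) simp_all
    ultimately show "boundary CARD('n) 1 (coords z j) (coords (0 :: ('d, 'n) points) j) q = 0"
      using pint_minimiser[of 1 q "CARD('n)" "coords z j" "coords (0 :: ('d, 'n) points) j"] by simp
  qed simp
  then have "z = 0" by (intro coords_eqI) simp
  then show False using assms by simp
qed

text \<open>By homogeneity of degree two it suffices to bound the action from below on the unit sphere.\<close>

lemma total_action_coercive:
  "\<exists>c>0. \<forall>z :: ('d::finite, 'n::{finite,linorder}) points. total_action 1 z 0 \<ge> c * (norm z)\<^sup>2"
proof -
  let ?Q = "\<lambda>z :: ('d, 'n) points. total_action 1 z 0"
  have Q: "?Q = (\<lambda>z. - 4 * ln (gauss z))" by (simp add: gauss_def fun_eq_iff)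
  have "continuous_on UNIV (\<lambda>z :: ('d, 'n) points. - 4 * ln (gauss z))"
    by (intro continuous_intros continuous_gauss ballI) (metis gauss_pos less_irrefl)
  then have "continuous_on (sphere 0 1) ?Q" unfolding Q by (rule continuous_on_subset) simp
  moreover have "sphere (0 :: ('d, 'n) points) 1 \<noteq> {}" by simp
  ultimately obtain e where e: "e \<in> sphere 0 1" "\<And>u. u \<in> sphere 0 1 \<Longrightarrow> ?Q e \<le> ?Q u"
    using continuous_attains_inf[OF compact_sphere] by metis
  have "?Q e * (norm z)\<^sup>2 \<le> ?Q z" for z
  proof (cases "z = 0")
    case False
    then have "?Q e \<le> ?Q ((1 / norm z) *\<^sub>R z)" by (intro e) simp
    then show ?thesis
      using False unfolding total_action_scaleR by (simp add: field_simps)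
  next
    case True
    then show ?thesis using total_action_scaleR[of 0 z] by simp
  qed
  moreover have "?Q e > 0" using e(1) by (intro total_action_pos) auto
  ultimately show ?thesis by blast
qed

lemma integrable_exp_neg_norm_sq:
  assumes c: "c > 0"
  shows "integrable lborel (\<lambda>z::'a::euclidean_space. exp (- c * (norm z)\<^sup>2))"
proof -
  define I where "I = (\<integral>x. exp (- c * x\<^sup>2) \<partial>(lborel :: real measure))"
  have 1: "integrable lborel (\<lambda>x::real. exp (- c * x\<^sup>2))"
  proof -
    (* The variance for which the exponent of the normal density is - c * x^2. *)
    define \<sigma> where "\<sigma> = sqrt (1 / (2 * c))"
    have \<sigma>: "\<sigma>\<^sup>2 = 1 / (2 * c)" "\<sigma> > 0" using c by (simp_all add: \<sigma>_def)
    have "exp (- c * x\<^sup>2) = sqrt (2 * pi * \<sigma>\<^sup>2) * normal_density 0 \<sigma> x" for x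
      unfolding normal_density_def \<sigma>(1) using c by simp
    then show ?thesis using \<sigma>(2) by simp
  qed
  have "(\<integral>\<^sup>+(z::'a). ennreal (exp (- c * (norm z)\<^sup>2)) \<partial>lborel)
      = (\<integral>\<^sup>+(z::'a). (\<Prod>b\<in>Basis. ennreal (exp (- c * (z \<bullet> b)\<^sup>2))) \<partial>lborel)"
  proof (intro nn_integral_cong)
    fix z :: 'a
    have "(norm z)\<^sup>2 = (\<Sum>b\<in>Basis. (z \<bullet> b)\<^sup>2)"
      unfolding power2_norm_eq_inner by (subst euclidean_inner) (simp add: power2_eq_square)
    then show "ennreal (exp (- c * (norm z)\<^sup>2)) = (\<Prod>b\<in>Basis. ennreal (exp (- c * (z \<bullet> b)\<^sup>2)))"
      by (simp add: prod_ennreal sum_distrib_left exp_sum flip: sum_negf)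
  qed
  also have "\<dots> = (\<Prod>b\<in>(Basis :: 'a set). \<integral>\<^sup>+x. ennreal (exp (- c * x\<^sup>2)) \<partial>lborel)"
    by (intro nn_integral_lborel_prod) auto
  also have "\<dots> = (\<Prod>b\<in>(Basis :: 'a set). ennreal I)"
    unfolding I_def using nn_integral_eq_integral[OF 1] by simp
  also have "\<dots> < \<infinity>" by (simp add: I_def prod_ennreal ennreal_power)
  finally show ?thesis by (intro integrableI_nonneg) auto
qed

lemma integrable_gauss: "integrable lborel gauss"
proof -
  obtain c where c: "c > 0" "\<And>z :: ('a, 'b) points. total_action 1 z 0 \<ge> c * (norm z)\<^sup>2"
    using total_action_coercive by blast
  show ?thesis
  proof (rule Bochner_Integration.integrable_bound)
    show "integrable lborel (\<lambda>z::('a, 'b) points. exp (- (c / 4) * (norm z)\<^sup>2))"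
      using c by (intro integrable_exp_neg_norm_sq) simp
    show "AE z in lborel. norm (gauss (z::('a, 'b) points)) \<le> norm (exp (- (c / 4) * (norm z)\<^sup>2))"
      using c(2) by (intro AE_I2) (simp add: gauss_def)
  qed simp
qed

definition gauss_integral :: "('d::finite, 'n::{finite,linorder}) points itself \<Rightarrow> real" where
  "gauss_integral T = (LINT z::('d, 'n) points|lborel. gauss z)"

lemma gauss_integral_pos: "gauss_integral (T :: ('d::finite, 'n::{finite,linorder}) points itself) > 0"
proof -
  have "gauss_integral T \<noteq> 0"
  proof
    assume "gauss_integral T = 0"
    then have "AE z::('d, 'n) points in lborel. gauss z = 0"
      unfolding gauss_integral_def
      using integral_nonneg_eq_0_iff_AE[OF integrable_gauss] less_imp_le[OF gauss_pos] by auto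
    then have "AE z::('d, 'n) points in lborel. False"
      using gauss_pos by (auto elim!: eventually_mono simp: less_le)
    then have "ae_filter (lborel :: ('d, 'n) points measure) = bot"
      by (simp add: trivial_limit_def)
    then show False by (simp add: ae_filter_eq_bot_iff)
  qed
  moreover have "gauss_integral T \<ge> 0"
    unfolding gauss_integral_def using less_imp_le[OF gauss_pos] by (intro integral_nonneg_AE AE_I2)
  ultimately show ?thesis by simp
qed

lemma Basis_points:
  "(Basis :: ('d::finite, 'n::finite) points set) = (\<lambda>p. axis (fst p) (axis (snd p) 1)) ` UNIV"
  by (auto simp: Basis_vec_def image_def)

lemma rescale_Basis:
  fixes b :: "('d::finite, 'n::{finite,linorder}) points"
  assumes "b \<in> Basis"
  shows "rescale t b = (rescale t b \<bullet> b) *\<^sub>R b"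
proof -
  obtain i j where b: "b = axis i (axis j 1)" using assms by (auto simp: Basis_points)
  have "rescale t b = (t powr (real CARD('n) - real (card {..i}) + 1 / 2)) *\<^sub>R b"
    by (simp add: b rescale_def vec_eq_iff axis_def)
  then show ?thesis using assms by simp
qed

lemma rescale_diag:
  "rescale t (axis i (axis j 1)) \<bullet> axis i (axis j (1::real))
     = t powr (real CARD('n) - real (card {..i}) + 1 / 2)" for i :: "'n::{finite,linorder}"
  by (simp add: inner_axis rescale_def inner_axis_axis)

text \<open>The exponents are \<open>k + 1 / 2\<close> for \<open>k < n\<close>.\<close>

lemma sum_scaling_exponents:
  "(\<Sum>i\<in>(UNIV :: 'n::{finite,linorder} set). real CARD('n) - real (card {..i}) + 1 / 2) = (real CARD('n))\<^sup>2 / 2"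
proof -
  have "(\<Sum>k=1..n. real k) = real n * (real n + 1) / 2" for n
    by (induction n) (simp_all add: field_simps)
  moreover have "(\<Sum>k=1..n. real n - real k + 1 / 2) = real n * real n - (\<Sum>k=1..n. real k) + real n / 2" for n
    by (simp add: sum.distrib sum_subtractf)
  ultimately have "(\<Sum>k=1..n. real n - real k + 1 / 2) = (real n)\<^sup>2 / 2" for n
    by (simp add: power2_eq_square field_simps)
  then show ?thesis
    using sum.reindex_bij_betw[OF bij_betw_card_atMost[where 'n='n],
      of "\<lambda>k. real CARD('n) - real k + 1 / 2"] by simp
qed

lemma prod_rescale_Basis:
  assumes "t > 0"
  shows "(\<Prod>b\<in>Basis. \<bar>rescale t b \<bullet> (b :: ('d::finite, 'n::{finite,linorder}) points)\<bar>)
    = t powr (real (CARD('n)\<^sup>2 * CARD('d)) / 2)"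
proof -
  have "inj (\<lambda>p. axis (fst p) (axis (snd p) 1) :: ('d, 'n) points)"
    by (auto simp: inj_def axis_eq_axis prod_eq_iff)
  then have "(\<Prod>b\<in>Basis. \<bar>rescale t b \<bullet> (b :: ('d, 'n) points)\<bar>)
      = (\<Prod>(i, j)\<in>(UNIV :: ('n \<times> 'd) set). t powr (real CARD('n) - real (card {..i}) + 1 / 2))"
    unfolding Basis_points by (simp add: prod.reindex rescale_diag case_prod_beta comp_def)
  also have "\<dots> = (\<Prod>i\<in>(UNIV :: 'n set). \<Prod>j\<in>(UNIV :: 'd set). t powr (real CARD('n) - real (card {..i}) + 1 / 2))"
    unfolding prod.cartesian_product UNIV_Times_UNIV ..
  also have "\<dots> = (\<Prod>i\<in>(UNIV :: 'n set). t powr (real CARD('n) - real (card {..i}) + 1 / 2)) ^ CARD('d)"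
    by (simp add: prod_power_distrib)
  also have "\<dots> = (t powr ((real CARD('n))\<^sup>2 / 2)) ^ CARD('d)"
    using assms by (simp flip: powr_sum add: sum_scaling_exponents)
  also have "\<dots> = t powr (real (CARD('n)\<^sup>2 * CARD('d)) / 2)"
    using assms by (simp add: powr_power mult.commute)
  finally show ?thesis .
qed

text \<open>The substitution \<open>x = free_flow t y + rescale t z\<close>. Its Jacobian cancels the power of \<open>t\<close> in the
  kernel, so that \<open>t\<close> and \<open>y\<close> remain only in the argument of \<open>\<phi>\<close>. The case \<open>\<phi> = 1\<close> is the
  normalisation, and a test function \<open>\<phi>\<close> gives the initial condition.\<close>

lemma integral_kernel:
  fixes y :: "('d::finite, 'n::{finite,linorder}) points" and \<phi> :: "('d, 'n) points \<Rightarrow> real"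
  assumes t: "t > 0" and \<phi>: "continuous_on UNIV \<phi>"
  shows "(LINT x|lborel. kernel \<beta> t x y * \<phi> x)
    = \<beta> * (LINT z|lborel. gauss z * \<phi> (free_flow t y + rescale t z))"
proof -
  define a where "a = real (CARD('n)\<^sup>2 * CARD('d)) / 2"
  let ?f = "\<lambda>x. smooth_kernel \<beta> y (t, x) * \<phi> x"
  define c where "c b = rescale t b \<bullet> b" for b :: "('d, 'n) points"
  let ?T = "\<lambda>z. free_flow t y + (\<Sum>b\<in>Basis. (c b * (z \<bullet> b)) *\<^sub>R b)"
  have T: "?T z = free_flow t y + rescale t z" for z
  proof -
    interpret linear "rescale t :: ('d, 'n) points \<Rightarrow> _" by (rule linear_rescale)
    have "rescale t z = rescale t (\<Sum>b\<in>Basis. (z \<bullet> b) *\<^sub>R b)" by (simp add: euclidean_representation)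
    also have "\<dots> = (\<Sum>b\<in>Basis. (z \<bullet> b) *\<^sub>R rescale t b)" by (simp add: sum scale)
    also have "\<dots> = (\<Sum>b\<in>Basis. (c b * (z \<bullet> b)) *\<^sub>R b)"
    proof (intro sum.cong refl)
      fix b :: "('d, 'n) points" assume "b \<in> Basis"
      from rescale_Basis[OF this, of t, folded c_def]
      show "(z \<bullet> b) *\<^sub>R rescale t b = (c b * (z \<bullet> b)) *\<^sub>R b"
        by (metis mult.commute scaleR_scaleR)
    qed
    finally show ?thesis by simp
  qed
  have [measurable]: "?f \<in> borel_measurable borel"
    by (intro borel_measurable_continuous_onI continuous_on_mult continuous_smooth_kernel t \<phi>)
  have nz: "c b \<noteq> 0" if "b \<in> Basis" for b :: "('d, 'n) points"
    using that t by (auto simp: c_def Basis_points rescale_diag)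
  have "lborel = density (distr lborel borel ?T) (\<lambda>_. \<Prod>b\<in>Basis. \<bar>c b\<bar>)"
    by (rule lborel_affine_euclidean[of c "free_flow t y"]) (rule nz)
  then have "integral\<^sup>L lborel ?f = integral\<^sup>L (density (distr lborel borel ?T) (\<lambda>_. \<Prod>b\<in>Basis. \<bar>c b\<bar>)) ?f"
    by (rule arg_cong[where f = "\<lambda>M. integral\<^sup>L M ?f"])
  also have "\<dots> = (\<Prod>b\<in>Basis. \<bar>c b\<bar>) * (LINT z|lborel. ?f (?T z))"
    by (subst integral_density) (simp_all add: integral_distr prod_nonneg)
  also have "\<dots> = t powr a * (LINT z|lborel. ?f (free_flow t y + rescale t z))"
    unfolding T using prod_rescale_Basis[OF t, where 'd='d and 'n='n] by (simp add: a_def c_def)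
  also have "(\<lambda>z. ?f (free_flow t y + rescale t z))
      = (\<lambda>z. (\<beta> * t powr - a) * (gauss z * \<phi> (free_flow t y + rescale t z)))"
    using t by (simp add: smooth_kernel_def total_action_free_flow total_action_rescale gauss_def a_def mult_ac fun_eq_iff)
  also have "t powr a * (LINT z|lborel. (\<beta> * t powr - a) * (gauss z * \<phi> (free_flow t y + rescale t z)))
      = \<beta> * (LINT z|lborel. gauss z * \<phi> (free_flow t y + rescale t z))"
    using t by (simp add: powr_minus)
  finally show ?thesis using t by (simp add: kernel_eq_smooth_kernel)
qed

lemma is_normalising_iff:
  fixes T :: "('d::finite, 'n::{finite,linorder}) points itself"
  shows "is_normalising T \<beta> \<longleftrightarrow> \<beta> = 1 / gauss_integral T"
proof -
  have "(LINT x|lborel. kernel \<beta> t x y) = \<beta> * gauss_integral T" if "t > 0" for t and y :: "('d, 'n) points"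
    using integral_kernel[OF that, of "\<lambda>x. 1" \<beta> y] by (simp add: gauss_integral_def)
  then have "is_normalising T \<beta> \<longleftrightarrow> \<beta> > 0 \<and> \<beta> * gauss_integral T = 1"
    unfolding is_normalising_def using zero_less_one by metis
  then show ?thesis
    using gauss_integral_pos[of T] zero_less_mult_pos2[of \<beta> "gauss_integral T"] by (auto simp: eq_divide_eq)
qed

lemma normalising_constant_eq: "normalising_constant T = 1 / gauss_integral T"
  unfolding normalising_constant_def is_normalising_iff by simp

lemma free_flow_tendsto: "((\<lambda>t. free_flow t y) \<longlongrightarrow> y) (at_right 0)"
proof -
  have "((\<lambda>t. free_flow t y) \<longlongrightarrow> free_flow 0 y) (at_right 0)"
    unfolding free_flow_def by (intro tendsto_vec_lambda tendsto_intros)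
  also have "free_flow 0 y = y"
    by (rule coords_eqI) (simp add: coords_free_flow jet_poly)
  finally show ?thesis .
qed

lemma rescale_tendsto:
  fixes z :: "('d::finite, 'n::{finite,linorder}) points"
  shows "((\<lambda>t. rescale t z) \<longlongrightarrow> 0) (at_right 0)"
proof (rule vec_tendstoI)
  fix i :: 'n
  have "card {..i} \<le> CARD('n)" by (intro card_mono) auto
  then have "((\<lambda>t. t powr (real CARD('n) - real (card {..i}) + 1 / 2)) \<longlongrightarrow> 0) (at_right 0)"
    by (intro tendsto_zero_powrI[where b = "real CARD('n) - real (card {..i}) + 1 / 2"])
      (auto simp: eventually_at_filter)
  from tendsto_scaleR[OF this tendsto_const[of "z $ i"]]
  show "((\<lambda>t. rescale t z $ i) \<longlongrightarrow> 0 $ i) (at_right 0)"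
    by (simp add: rescale_def)
qed

lemma test_function_continuous: "test_function \<phi> \<Longrightarrow> continuous_on UNIV \<phi>"
  unfolding test_function_def by (metis Ck_on.simps(1))

lemma test_function_bounded:
  assumes "test_function \<phi>"
  shows "\<exists>B. \<forall>x. \<bar>\<phi> x\<bar> \<le> B"
proof -
  let ?K = "closure {x. \<phi> x \<noteq> 0}"
  have "compact (\<phi> ` ?K)"
    using assms by (intro compact_continuous_image continuous_on_subset[OF test_function_continuous])
      (auto simp: test_function_def)
  then have "bounded (\<phi> ` ?K)" by (rule compact_imp_bounded)
  then obtain B where "\<forall>r\<in>\<phi> ` ?K. norm r \<le> B"
    unfolding bounded_iff ..
  then have B: "\<bar>\<phi> x\<bar> \<le> B" if "x \<in> ?K" for x
    using that by auto
  have "\<bar>\<phi> x\<bar> \<le> max B 0" for x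
    using B[of x] closure_subset[of "{x. \<phi> x \<noteq> 0}"] by (cases "\<phi> x = 0") auto
  then show ?thesis by blast
qed

text \<open>As \<open>t\<close> decreases to \<open>0\<close>, the point \<open>free_flow t y + rescale t z\<close> tends to \<open>y\<close> for each \<open>z\<close>, and
  the integrand is dominated by a multiple of \<open>gauss\<close>.\<close>

lemma tends_to_dirac_Phi:
  fixes y :: "('d::finite, 'n::{finite,linorder}) points"
  shows "tends_to_dirac (\<lambda>t x. Phi t x y) y"
  unfolding tends_to_dirac_def
proof (intro allI impI)
  fix \<phi> :: "('d, 'n) points \<Rightarrow> real" assume \<phi>: "test_function \<phi>"
  note cont = test_function_continuous[OF \<phi>]
  obtain B where B: "\<And>x. \<bar>\<phi> x\<bar> \<le> B" using test_function_bounded[OF \<phi>] by blast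
  let ?I = "gauss_integral TYPE(('d, 'n) points)"
  have [measurable]: "\<phi> \<in> borel_measurable borel"
    by (intro borel_measurable_continuous_onI cont)
  have "continuous_on UNIV (\<lambda>z. free_flow t y + rescale t z)" for t
    by (intro continuous_intros linear_continuous_on linear_rescale[unfolded linear_conv_bounded_linear])
  then have [measurable]: "(\<lambda>z. free_flow t y + rescale t z) \<in> borel_measurable borel" for t
    by (intro borel_measurable_continuous_onI)
  (* The limit is taken along 1 / t at infinity, the form of dominated convergence for a real
     parameter. *)
  have "((\<lambda>t. LINT z|lborel. gauss z * \<phi> (free_flow (inverse t) y + rescale (inverse t) z))
      \<longlongrightarrow> (LINT z::('d, 'n) points|lborel. gauss z * \<phi> y)) at_top"
  proof (rule integral_dominated_convergence_at_top[where w = "\<lambda>z::('d, 'n) points. gauss z * B" and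
      s = "\<lambda>t z. gauss z * \<phi> (free_flow (inverse t) y + rescale (inverse t) z)" and f = "\<lambda>z::('d, 'n) points. gauss z * \<phi> y"])
    show "integrable lborel (\<lambda>z::('d, 'n) points. gauss z * B)"
      by (intro integrable_mult_left integrable_gauss)
    show "AE z in lborel. ((\<lambda>t. gauss z * \<phi> (free_flow (inverse t) y + rescale (inverse t) z))
        \<longlongrightarrow> gauss z * \<phi> y) at_top"
    proof (rule AE_I2)
      fix z :: "('d, 'n) points"
      have "((\<lambda>t. free_flow t y + rescale t z) \<longlongrightarrow> y + 0) (at_right 0)"
        by (intro tendsto_add free_flow_tendsto rescale_tendsto)
      moreover have "isCont \<phi> (y + 0)"
        using cont by (simp add: continuous_on_eq_continuous_at)
      ultimately have "((\<lambda>t. \<phi> (free_flow t y + rescale t z)) \<longlongrightarrow> \<phi> (y + 0)) (at_right 0)"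
        by (rule isCont_tendsto_compose[rotated])
      then show "((\<lambda>t. gauss z * \<phi> (free_flow (inverse t) y + rescale (inverse t) z))
        \<longlongrightarrow> gauss z * \<phi> y) at_top"
        unfolding filterlim_at_right_to_top by (intro tendsto_mult tendsto_const) simp
    qed
    show "eventually (\<lambda>t. AE z in lborel.
        norm (gauss z * \<phi> (free_flow (inverse t) y + rescale (inverse t) z)) \<le> gauss z * B) at_top"
    proof (intro always_eventually allI AE_I2)
      fix t and z :: "('d, 'n) points"
      show "norm (gauss z * \<phi> (free_flow (inverse t) y + rescale (inverse t) z)) \<le> gauss z * B"
        unfolding norm_mult using B gauss_pos[of z] by (intro mult_mono) auto
    qed
  qed simp_all
  then have "((\<lambda>t. LINT z|lborel. gauss z * \<phi> (free_flow t y + rescale t z))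
      \<longlongrightarrow> ?I * \<phi> y) (at_right 0)"
    unfolding filterlim_at_right_to_top[of "\<lambda>t. LINT z|lborel. gauss z * \<phi> (free_flow t y + rescale t z)"]
    by (simp add: gauss_integral_def)
  then have "((\<lambda>t. 1 / ?I * (LINT z|lborel. gauss z * \<phi> (free_flow t y + rescale t z)))
      \<longlongrightarrow> 1 / ?I * (?I * \<phi> y)) (at_right 0)"
    by (intro tendsto_mult tendsto_const)
  moreover have "1 / ?I * (?I * \<phi> y) = \<phi> y"
    using gauss_integral_pos[of "TYPE(('d, 'n) points)"] by simp
  moreover have "eventually (\<lambda>t. (LINT x|lborel. Phi t x y * \<phi> x)
      = 1 / ?I * (LINT z|lborel. gauss z * \<phi> (free_flow t y + rescale t z))) (at_right 0)"
    unfolding Phi_def normalising_constant_eq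
    by (auto simp: eventually_at_filter integral_kernel[OF _ cont])
  ultimately show "((\<lambda>t. LINT x|lborel. Phi t x y * \<phi> x) \<longlongrightarrow> \<phi> y) (at_right 0)"
    by (simp only: tendsto_cong)
qed

theorem theorem1p1:
  shows "(\<exists>!\<beta>. is_normalising TYPE(('d::finite, 'n::{finite,linorder}) points) \<beta>) \<and>
    is_fundamental_solution (Phi :: real \<Rightarrow> ('d, 'n) points \<Rightarrow> ('d, 'n) points \<Rightarrow> real)"
  unfolding is_normalising_iff is_fundamental_solution_def
  using kolmogorov_solution_kernel tends_to_dirac_Phi by (auto simp: Phi_def)

end
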